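(* Let $0<p\le2$ and $\gamma_p=\frac2p-1$. Let $k\in\mathbb Z\setminus\{0\}$, let $\pi_{ik}$ be the corresponding discrete series representation of $G=\mathrm{SL}(2,\mathbb R)$, and let $n\in\mathbb Z(k)$. Then the following conditions are equivalent: (1) $|k|\ge\gamma_p$; (2) $\psi^{n,n}_{ik}\in L^{p,\infty}(G)$. Moreover, if $|k|=\gamma_p$, then $\psi^{n,n}_{ik}\in L^{p,q}(G)$ if and only if $q=\infty$ (where $q\in(0,\infty]$).
   Context: $G=\mathrm{SL}(2,\mathbb R)$; $k_\theta=\begin{pmatrix}\cos\theta&\sin\theta\\-\sin\theta&\cos\theta\end{pmatrix}$, $K=\{k_\theta\}$; $a_t=\mathrm{diag}(e^t,e^{-t})$; $n_v=\begin{pmatrix}1&v\\0&1\end{pmatrix}$. Each $x\in G$ is uniquely $x=k_\theta a_tn_v$; $K(x)=k_\theta$, $H(x)=t$. $dk$ is the normalized Haar measure of $K$; the Haar measure $dx$ of $G$ is given by $\int_Gf(x)dx=\int_K\int_0^\infty\int_Kf(k_1a_tk_2)\,2\sinh(2t)\,dk_1\,dt\,dk_2$. $e_n(k_\theta)=e^{in\theta}$. For $k\ge1$, $\mathbb Z(k)=\{m\in\mathbb Z: m\ge k+1,\ m\equiv k+1 \bmod 2\}$; for $k\le-1$, $\mathbb Z(k)=\{m\in\mathbb Z:m\le k-1,\ m\equiv k+1\bmod 2\}$. $\pi_{ik}$ is the discrete series representation whose $K$-types are the $e_m$, $m\in\mathbb Z(k)$. For $n\in\mathbb Z(k)$, $\psi^{n,n}_{ik}(x)=\langle\pi_{ik}(x)e_n^k,e_n^k\rangle_k$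 is its canonical $(n,n)$-th matrix coefficient ($e_n^k$ a unit vector of $K$-type $n$); equivalently $$\psi^{n,n}_{ik}(x)=\phi^{n,n}_{\tau,i|k|}(x),\qquad \phi^{n,n}_{\tau,\lambda}(x)=\int_Ke^{-(i\lambda+1)H(xk')}e_n(k'^{-1})\overline{e_n(K(xk')^{-1})}\,dk',$$ where $\tau$ denotes the parity of $n$. Lorentz spaces: with $d_f(\alpha)$ the Haar measure of $\{x\in G:|f(x)|>\alpha\}$, $f\in L^{p,q}(G)$ iff $\int_0^\infty\alpha^qd_f(\alpha)^{q/p}\frac{d\alpha}\alpha<\infty$ (for $q<\infty$), and $f\in L^{p,\infty}(G)$ iff $\sup_{\alpha>0}\alpha^pd_f(\alpha)<\infty$. *)

theory Defs
  imports "HOL-Analysis.Analysis"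
begin

section \<open>The group and its Iwasawa decomposition\<close>

definition SL2 :: "(real^2^2) set" where
  "SL2 = {x. det x = 1}"

definition k_rot :: "real \<Rightarrow> real^2^2" where
  "k_rot \<theta> = vector [vector [cos \<theta>, sin \<theta>], vector [- sin \<theta>, cos \<theta>]]"

definition a_diag :: "real \<Rightarrow> real^2^2" where
  "a_diag t = vector [vector [exp t, 0], vector [0, exp (- t)]]"

definition n_upper :: "real \<Rightarrow> real^2^2" where
  "n_upper v = vector [vector [1, v], vector [0, 1]]"

definition K_group :: "(real^2^2) set" where
  "K_group = range k_rot"

definition iwasawa_K :: "real^2^2 \<Rightarrow> real^2^2" where
  "iwasawa_K x = (THE \<kappa>. \<kappa> \<in> K_group \<and> (\<exists>t v. x = \<kappa> ** a_diag t ** n_upper v))"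

definition iwasawa_H :: "real^2^2 \<Rightarrow> real" where
  "iwasawa_H x = (THE t. \<exists>\<theta> v. x = k_rot \<theta> ** a_diag t ** n_upper v)"

section \<open>Haar measures\<close>

definition haar_K :: "(real^2^2) measure" where
  "haar_K = distr (uniform_measure lborel {0..<2 * pi}) (restrict_space borel K_group) k_rot"

text \<open>The measure \<open>2 sinh(2t) dk\<^sub>1 dt dk\<^sub>2\<close> on \<open>K \<times> (0,\<infinity>) \<times> K\<close>, pushed forward along the
  Cartan decomposition \<open>(k\<^sub>1, t, k\<^sub>2) \<mapsto> k\<^sub>1 a\<^sub>t k\<^sub>2\<close>.\<close>

definition haar_SL2 :: "(real^2^2) measure" where
  "haar_SL2 =
     distr (haar_K \<Otimes>\<^sub>M
            (density lborel (\<lambda>t. ennreal (2 * sinh (2 * t)) * indicator {0<..} t) \<Otimes>\<^sub>M haar_K))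
       (restrict_space borel SL2) (\<lambda>(k\<^sub>1, t, k\<^sub>2). k\<^sub>1 ** a_diag t ** k\<^sub>2)"

section \<open>Lorentz spaces\<close>

definition distribution_fun :: "'a measure \<Rightarrow> ('a \<Rightarrow> complex) \<Rightarrow> real \<Rightarrow> ennreal" where
  "distribution_fun M f \<alpha> = emeasure M {x \<in> space M. norm (f x) > \<alpha>}"

text \<open>Only used with exponent \<open>r > 0\<close>.\<close>

definition ennreal_powr :: "ennreal \<Rightarrow> real \<Rightarrow> ennreal" where
  "ennreal_powr x r = (if x = \<infinity> then \<infinity> else ennreal (enn2real x powr r))"

definition lorentz_space :: "'a measure \<Rightarrow> real \<Rightarrow> ennreal \<Rightarrow> ('a \<Rightarrow> complex) set" where
  "lorentz_space M p q = {f \<in> borel_measurable M.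
     if q = \<infinity>
     then (SUP \<alpha>\<in>{0<..}. ennreal (\<alpha> powr p) * distribution_fun M f \<alpha>) < \<infinity>
     else (\<integral>\<^sup>+\<alpha>\<in>{0<..}. ennreal (\<alpha> powr enn2real q)
             * ennreal_powr (distribution_fun M f \<alpha>) (enn2real q / p) * ennreal (1 / \<alpha>) \<partial>lborel) < \<infinity>}"

section \<open>Discrete series\<close>

text \<open>The character \<open>e\<^sub>n(k\<^sub>\<theta>) = exp(in\<theta>)\<close> of \<open>K\<close>, read off from the first row
  \<open>(cos \<theta>, sin \<theta>)\<close>; see \<open>e_char_k_rot\<close> below. Only its values on \<open>K\<close> matter.\<close>

definition e_char :: "int \<Rightarrow> real^2^2 \<Rightarrow> complex" where
  "e_char n \<kappa> = Complex (\<kappa> $ 1 $ 1) (\<kappa> $ 1 $ 2) powi n"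

lemma e_char_k_rot: "e_char n (k_rot \<theta>) = exp (\<i> * of_int n * of_real \<theta>)"
proof -
  have "e_char n (k_rot \<theta>) = cis \<theta> powi n"
    by (simp add: e_char_def k_rot_def cis.ctr)
  also have "\<dots> = cis (of_int n * \<theta>)"
    by (simp add: cis_power_int)
  finally show ?thesis
    by (simp add: cis_conv_exp mult.assoc)
qed

definition fourier_K :: "(real^2^2 \<Rightarrow> complex) \<Rightarrow> int \<Rightarrow> complex" where
  "fourier_K f m = (\<integral>\<kappa>. f \<kappa> * cnj (e_char m \<kappa>) \<partial>haar_K)"

text \<open>The principal series in the compact picture, acting on functions on \<open>K\<close>:
  \[(\pi_\nu(x) f)(\kappa) = e^{(i\nu-1)H(x^{-1}\kappa^{-1})} f(K(x^{-1}\kappa^{-1})^{-1}).\]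
  The two parities \<open>\<tau>\<close> are the invariant subspaces of even and odd functions, with the same
  formula for the action. The substitution \<open>\<kappa>\<^sup>-\<^sup>1 = K(x\<kappa>')\<close>, under which
  \<open>H(x\<^sup>-\<^sup>1\<kappa>\<^sup>-\<^sup>1) = -H(x\<kappa>')\<close>, \<open>K(x\<^sup>-\<^sup>1\<kappa>\<^sup>-\<^sup>1) = \<kappa>'\<close> and
  \<open>d\<kappa> = exp(-2H(x\<kappa>')) d\<kappa>'\<close>, turns \<open>\<langle>\<pi>\<^sub>\<nu>(x)e\<^sub>n, e\<^sub>n\<rangle>\<close> into
  \[\phi^{n,n}_{\tau,\nu}(x)
     = \int_K e^{-(i\nu+1)H(x\kappa')} e_n(\kappa'^{-1}) \overline{e_n(K(x\kappa')^{-1})}\,d\kappa'.\]\<close>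

definition principal_series ::
    "complex \<Rightarrow> real^2^2 \<Rightarrow> (real^2^2 \<Rightarrow> complex) \<Rightarrow> real^2^2 \<Rightarrow> complex" where
  "principal_series \<nu> x f \<kappa> =
     (let y = matrix_inv x ** matrix_inv \<kappa>
      in exp ((\<i> * \<nu> - 1) * of_real (iwasawa_H y)) * f (matrix_inv (iwasawa_K y)))"

definition Z_types :: "int \<Rightarrow> int set" where
  "Z_types k = (if k \<ge> 1 then {m. m \<ge> k + 1 \<and> even (m - (k + 1))}
                else if k \<le> - 1 then {m. m \<le> k - 1 \<and> even (m - (k + 1))} else {})"

text \<open>For \<open>k \<noteq> 0\<close>, the discrete series \<open>\<pi>\<^bsub>ik\<^esub>\<close> is the subrepresentation of the principal series
  with parameter \<open>i|k|\<close> spanned by the \<open>K\<close>-types \<open>e\<^sub>m\<close>, \<open>m \<in> \<int>(k)\<close>. The invariant inner product is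
  not that of \<open>L\<^sup>2(K)\<close>: the \<open>e\<^sub>m\<close> stay orthogonal, and since the raising and lowering operators act
  by \<open>e\<^sub>m \<mapsto> (1 + |k| \<plusminus> m) e\<^bsub>m\<plusminus>2\<^esub>\<close> up to a common constant, skew-adjointness forces
  \[\|e_{m+2}\|_k^2 / \|e_m\|_k^2 = (m+1-|k|)/(m+1+|k|) \qquad (m \ge |k|+1),\]
  and symmetrically for negative \<open>m\<close>. We normalise \<open>\<parallel>e\<^sub>m\<parallel>\<^sub>k = 1\<close> at the extremal type
  \<open>|m| = |k| + 1\<close>. The Hilbert space of \<open>\<pi>\<^bsub>ik\<^esub>\<close> is the completion of the dense invariant
  subspace \<open>ds_space k\<close> of continuous vectors on \<open>K\<close>; it contains all \<open>K\<close>-finite vectors and their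
  translates, so matrix coefficients of \<open>K\<close>-finite vectors are computed inside it.\<close>

definition ds_weight :: "int \<Rightarrow> int \<Rightarrow> real" where
  "ds_weight k m = 1 / real (nat ((\<bar>m\<bar> + \<bar>k\<bar> - 1) div 2) choose nat \<bar>k\<bar>)"

definition ds_inner :: "int \<Rightarrow> (real^2^2 \<Rightarrow> complex) \<Rightarrow> (real^2^2 \<Rightarrow> complex) \<Rightarrow> complex" where
  "ds_inner k f g =
     (\<Sum>\<^sub>\<infinity>m\<in>Z_types k. of_real (ds_weight k m) * fourier_K f m * cnj (fourier_K g m))"

definition ds_space :: "int \<Rightarrow> (real^2^2 \<Rightarrow> complex) set" where
  "ds_space k = {f. continuous_on K_group f \<and> (\<forall>m. m \<notin> Z_types k \<longrightarrow> fourier_K f m = 0)}"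

definition discrete_series ::
    "int \<Rightarrow> real^2^2 \<Rightarrow> (real^2^2 \<Rightarrow> complex) \<Rightarrow> (real^2^2 \<Rightarrow> complex)" where
  "discrete_series k x = restrict (principal_series (\<i> * of_int \<bar>k\<bar>) x) (ds_space k)"

definition ds_basis :: "int \<Rightarrow> int \<Rightarrow> real^2^2 \<Rightarrow> complex" where
  "ds_basis k n = (\<lambda>\<kappa>. e_char n \<kappa> / of_real (sqrt (Re (ds_inner k (e_char n) (e_char n)))))"

definition ds_coeff :: "int \<Rightarrow> int \<Rightarrow> real^2^2 \<Rightarrow> complex" where
  "ds_coeff k n x = ds_inner k (discrete_series k x (ds_basis k n)) (ds_basis k n)"

end

theory Submission
  imports Defs
begin

text \<open>The idea is to compute the matrix coefficient exactly and to read its size off the formula.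
  In the \<open>SU(1,1)\<close> model, \<open>x\<^sup>-\<^sup>1\<close> acts on the unit circle through \<open>w \<mapsto> \<alpha> w + \<beta> w\<^sup>-\<^sup>1\<close>, where
  \<open>|\<alpha>|\<^sup>2 - |\<beta>|\<^sup>2 = 1\<close>. The invariant inner product is diagonal in the characters, so its weights cancel
  in a diagonal coefficient, which becomes a Fourier coefficient over the circle
  (\<open>ds_coeff_eq_fourier_K\<close>). For \<open>|n| = 2j + |k| + 1\<close> the integrand, up to conjugation, is a polynomial in \<open>w\<^sup>-\<^sup>2\<close> times a
  negative binomial power in \<open>w\<^sup>2\<close>, and expanding the latter (\<open>discrete_series_circle_integral\<close>) gives
  \[|\psi^{n,n}_{ik}(x)| = |\alpha|^{-(|k|+1)}\, |Q(1 - |\alpha|^{-2})|\]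
  with a polynomial \<open>Q\<close> that satisfies \<open>Q(1) \<noteq> 0\<close> by the Vandermonde identity (\<open>norm_ds_coeff\<close>,
  \<open>ds_poly_1\<close>). On \<open>K a\<^sub>t K\<close> one has \<open>|\<alpha>| = cosh t\<close>, so the coefficient is at most a constant times
  \<open>(cosh t)\<^bsup>-M\<^esup>\<close>, \<open>M = |k| + 1\<close>, and at least such a constant multiple outside a compact set
  (\<open>ds_coeff_bounds\<close>).

  For \<open>S \<ge> 1\<close> the set \<open>{cosh t < S}\<close> has Haar measure \<open>2(S\<^sup>2 - 1)\<close>, so the distribution function is
  comparable to \<open>\<epsilon>\<^bsup>-2/M\<^esup>\<close> as the level \<open>\<epsilon>\<close> tends to \<open>0\<close>, and vanishes for large levels. Hence
  weak \<open>L\<^sup>p\<close> membership means \<open>p \<ge> 2/M\<close>, which is \<open>|k| \<ge> 2/p - 1\<close>. When equality holds, the integrand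
  defining \<open>L\<^bsup>p,q\<^esup>\<close> with \<open>q < \<infinity>\<close> is at least a constant times \<open>1/\<epsilon>\<close> near \<open>0\<close>, and the integral diverges.\<close>

section \<open>Iwasawa components from the first column\<close>

lemma matrix_eq_2_iff:
  fixes x y :: "real^2^2"
  shows "x = y \<longleftrightarrow> x$1$1 = y$1$1 \<and> x$1$2 = y$1$2 \<and> x$2$1 = y$2$1 \<and> x$2$2 = y$2$2"
  by (auto simp: vec_eq_iff forall_2)

lemma matrix_mult_2_entry:
  fixes x y :: "real^2^2"
  shows "(x ** y) $ i $ j = x$i$1 * y$1$j + x$i$2 * y$2$j"
  by (simp add: matrix_matrix_mult_def sum_2)

lemma matrix_inv_SL2:
  assumes "x \<in> SL2"
  shows "matrix_inv x = vector [vector [x$2$2, - (x$1$2)], vector [- (x$2$1), x$1$1]]" (is "_ = ?y")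
proof -
  have d: "x$1$1 * x$2$2 - x$1$2 * x$2$1 = 1" using assms by (simp add: SL2_def det_2)
  have 1: "x ** ?y = mat 1" "?y ** x = mat 1"
    using d by (auto simp: matrix_eq_2_iff matrix_mult_2_entry mat_def algebra_simps)
  then have "x ** matrix_inv x = mat 1"
    unfolding matrix_inv_def by (metis (mono_tags, lifting) someI_ex)
  then have "?y ** (x ** matrix_inv x) = ?y" by simp
  then show ?thesis by (simp only: matrix_mul_assoc 1 matrix_mul_lid)
qed

lemma k_rot_in_SL2: "k_rot \<theta> \<in> SL2"
  by (simp add: SL2_def det_2 k_rot_def flip: power2_eq_square)

lemma iwasawa_product:
  "k_rot \<theta> ** a_diag t ** n_upper v =
     vector [vector [exp t * cos \<theta>, exp t * cos \<theta> * v + exp (- t) * sin \<theta>],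
             vector [- (exp t * sin \<theta>), exp (- t) * cos \<theta> - exp t * sin \<theta> * v]]"
  by (simp add: matrix_eq_2_iff matrix_mult_2_entry k_rot_def a_diag_def n_upper_def algebra_simps)

text \<open>Right multiplication by \<open>n\<^sub>v\<close> fixes the first column, so the column \<open>e\<^sup>t(cos \<theta>, -sin \<theta>)\<close> of
  \<open>k\<^sub>\<theta> a\<^sub>t n\<^sub>v\<close>, read as the complex number \<open>e\<^sup>t e\<^bsup>-i\<theta>\<^esup>\<close>, carries both Iwasawa components that the
  principal series uses.\<close>
definition first_col :: "real^2^2 \<Rightarrow> complex" where
  "first_col x = Complex (x$1$1) (x$2$1)"

lemma first_col_iwasawa: "first_col (k_rot \<theta> ** a_diag t ** n_upper v) = of_real (exp t) * cis (- \<theta>)"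
  by (simp add: iwasawa_product first_col_def complex_eq_iff)

text \<open>The first column dictates \<open>\<theta>\<close> and \<open>t\<close>. The value of \<open>v\<close> is the Gram--Schmidt coefficient of the
  second column along the first; the determinant condition then makes the second column match.\<close>
lemma iwasawa_exists:
  assumes "x \<in> SL2"
  shows "\<exists>\<theta> t v. x = k_rot \<theta> ** a_diag t ** n_upper v"
proof -
  have d: "x$1$1 * x$2$2 - x$1$2 * x$2$1 = 1" using assms by (simp add: SL2_def det_2)
  define r where "r = norm (first_col x)"
  have "first_col x \<noteq> 0" using d by (auto simp: first_col_def complex_eq_iff)
  then have r: "r > 0" by (simp add: r_def)
  have r2: "x$1$1 ^ 2 + x$2$1 ^ 2 = r ^ 2" by (simp add: r_def first_col_def cmod_power2)
  define \<theta> where "\<theta> = - Arg (first_col x)"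
  have c: "first_col x = of_real r * cis (- \<theta>)"
    unfolding r_def \<theta>_def by (metis minus_minus rcis_cmod_Arg rcis_def)
  have e: "x$1$1 = r * cos \<theta>" "x$2$1 = - (r * sin \<theta>)"
    using arg_cong[OF c, of Re] arg_cong[OF c, of Im] by (simp_all add: first_col_def)
  define v where "v = (x$1$1 * x$1$2 + x$2$1 * x$2$2) / r^2"
  have "x = k_rot \<theta> ** a_diag (ln r) ** n_upper v"
  proof -
    have 1: "r * cos \<theta> * v + sin \<theta> / r = x$1$2"
    proof -
      have "r * cos \<theta> * v + sin \<theta> / r = x$1$1 * v - x$2$1 / r^2"
        using r by (simp add: e field_simps power2_eq_square)
      also have "\<dots> = (x$1$1 * (x$1$1 * x$1$2 + x$2$1 * x$2$2) - x$2$1) / r^2"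
        by (simp add: v_def diff_divide_distrib)
      also have "x$1$1 * (x$1$1 * x$1$2 + x$2$1 * x$2$2) - x$2$1 = x$1$2 * r^2"
        unfolding r2[symmetric] using d by algebra
      finally show ?thesis using r by simp
    qed
    have 2: "cos \<theta> / r - r * sin \<theta> * v = x$2$2"
    proof -
      have "cos \<theta> / r - r * sin \<theta> * v = x$2$1 * v + x$1$1 / r^2"
        using r by (simp add: e field_simps power2_eq_square)
      also have "\<dots> = (x$2$1 * (x$1$1 * x$1$2 + x$2$1 * x$2$2) + x$1$1) / r^2"
        by (simp add: v_def field_simps add_divide_distrib)
      also have "x$2$1 * (x$1$1 * x$1$2 + x$2$1 * x$2$2) + x$1$1 = x$2$2 * r^2"
        unfolding r2[symmetric] using d by algebra
      finally show ?thesis using r by simp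
    qed
    show ?thesis using r 1 2 unfolding iwasawa_product
      by (simp add: matrix_eq_2_iff e exp_minus field_simps)
  qed
  then show ?thesis by blast
qed

lemma iwasawa_H_eq:
  assumes "x \<in> SL2"
  shows "iwasawa_H x = ln (norm (first_col x))"
proof -
  have *: "t = ln (norm (first_col x))" if "x = k_rot \<theta> ** a_diag t ** n_upper v" for \<theta> t v
    using that by (simp add: first_col_iwasawa norm_mult)
  obtain \<theta> t v where "x = k_rot \<theta> ** a_diag t ** n_upper v"
    using iwasawa_exists[OF assms] by blast
  then show ?thesis unfolding iwasawa_H_def using * by (intro the_equality) metis+
qed

lemma k_rot_eq_iff: "k_rot \<theta> = k_rot \<phi> \<longleftrightarrow> cis \<theta> = cis \<phi>"
  by (auto simp: k_rot_def matrix_eq_2_iff complex_eq_iff)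

lemma e_char_inv_iwasawa_K:
  assumes "x \<in> SL2"
  shows "e_char n (matrix_inv (iwasawa_K x)) = (sgn (first_col x)) powi n"
proof -
  have sg: "sgn (first_col x) = cis (- \<theta>)" if "x = k_rot \<theta> ** a_diag t ** n_upper v" for \<theta> t v
    using that by (simp add: first_col_iwasawa sgn_eq norm_mult)
  obtain \<theta> t v where x: "x = k_rot \<theta> ** a_diag t ** n_upper v"
    using iwasawa_exists[OF assms] by blast
  have "iwasawa_K x = k_rot \<theta>" unfolding iwasawa_K_def
  proof (rule the_equality)
    show "k_rot \<theta> \<in> K_group \<and> (\<exists>t v. x = k_rot \<theta> ** a_diag t ** n_upper v)"
      using x by (auto simp: K_group_def)
  next
    fix \<kappa> assume "\<kappa> \<in> K_group \<and> (\<exists>t v. x = \<kappa> ** a_diag t ** n_upper v)"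
    then obtain \<phi> t' v' where k: "\<kappa> = k_rot \<phi>" and "x = k_rot \<phi> ** a_diag t' ** n_upper v'"
      by (auto simp: K_group_def)
    then have "cis (- \<phi>) = cis (- \<theta>)" using sg x by metis
    then have "cis \<phi> = cis \<theta>" by (metis cis_cnj complex_cnj_cancel_iff)
    then show "\<kappa> = k_rot \<theta>" by (simp add: k k_rot_eq_iff)
  qed
  then have "e_char n (matrix_inv (iwasawa_K x)) = cis (- \<theta>) powi n"
    by (simp add: matrix_inv_SL2[OF k_rot_in_SL2] e_char_def, simp add: k_rot_def complex_eq_iff cis.ctr)
  then show ?thesis using sg[OF x] by simp
qed

section \<open>The principal series on a character\<close>

text \<open>The real-linear map \<open>x\<^sup>-\<^sup>1\<close> of \<open>\<real>\<^sup>2 = \<complex>\<close> is \<open>w \<mapsto> \<alpha> w + \<beta> cnj w\<close> with \<open>\<alpha> = cayley_diag x\<close> and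
  \<open>\<beta> = cayley_off x\<close>. These are the matrix entries of \<open>x\<^sup>-\<^sup>1\<close> in the
  model \<open>SU(1,1)\<close>, to which the Cayley transform carries \<open>SL(2,\<real>)\<close> and in which \<open>K\<close> is diagonal.\<close>
definition cayley_diag :: "real^2^2 \<Rightarrow> complex" where
  "cayley_diag x = Complex ((x$1$1 + x$2$2) / 2) ((x$1$2 - x$2$1) / 2)"

definition cayley_off :: "real^2^2 \<Rightarrow> complex" where
  "cayley_off x = Complex ((x$2$2 - x$1$1) / 2) (- (x$1$2 + x$2$1) / 2)"

lemma cayley_norm_diff:
  assumes "x \<in> SL2"
  shows "norm (cayley_diag x) ^ 2 - norm (cayley_off x) ^ 2 = 1"
proof -
  have d: "x$1$1 * x$2$2 - x$1$2 * x$2$1 = 1" using assms by (simp add: SL2_def det_2)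
  have "norm (cayley_diag x) ^ 2 - norm (cayley_off x) ^ 2 = x$1$1 * x$2$2 - x$1$2 * x$2$1"
    unfolding cmod_power2 cayley_diag_def cayley_off_def complex.sel by (simp add: power2_eq_square field_simps)
  then show ?thesis using d by simp
qed

lemma cayley_off_less_diag:
  assumes "x \<in> SL2"
  shows "norm (cayley_off x) < norm (cayley_diag x)"
  by (rule power2_less_imp_less) (use cayley_norm_diff[OF assms] in auto)

lemma K_group_subset_SL2: "K_group \<subseteq> SL2"
  using k_rot_in_SL2 by (auto simp: K_group_def)

lemma SL2_mult: "x \<in> SL2 \<Longrightarrow> y \<in> SL2 \<Longrightarrow> x ** y \<in> SL2"
  by (simp add: SL2_def det_mul)

lemma SL2_matrix_inv: "x \<in> SL2 \<Longrightarrow> matrix_inv x \<in> SL2"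
  by (subst matrix_inv_SL2) (simp_all add: SL2_def det_2 mult.commute)

abbreviation first_row :: "real^2^2 \<Rightarrow> complex" where
  "first_row \<kappa> \<equiv> Complex (\<kappa>$1$1) (\<kappa>$1$2)"

lemma first_row_k_rot: "first_row (k_rot \<theta>) = cis \<theta>"
  by (simp add: k_rot_def complex_eq_iff)

lemma first_col_inv_mult_inv:
  assumes "x \<in> SL2" "\<kappa> \<in> K_group"
  shows "first_col (matrix_inv x ** matrix_inv \<kappa>) =
           cayley_diag x * first_row \<kappa> + cayley_off x * cnj (first_row \<kappa>)"
proof -
  have k: "\<kappa>$2$1 = - (\<kappa>$1$2)" "\<kappa>$2$2 = \<kappa>$1$1"
    using assms(2) by (auto simp: K_group_def k_rot_def)
  have "\<kappa> \<in> SL2" using assms(2) K_group_subset_SL2 by auto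
  then show ?thesis using assms(1)
    by (simp add: matrix_inv_SL2 k first_col_def matrix_mult_2_entry complex_eq_iff
          cayley_diag_def cayley_off_def field_simps)
qed

lemma cayley_orbit_nonzero:
  assumes "x \<in> SL2" "norm w = 1"
  shows "cayley_diag x * w + cayley_off x * cnj w \<noteq> 0"
proof
  assume "cayley_diag x * w + cayley_off x * cnj w = 0"
  then have "norm (cayley_diag x * w) = norm (cayley_off x * cnj w)"
    by (metis add_eq_0_iff norm_minus_cancel)
  then show False using cayley_off_less_diag[OF assms(1)] assms(2) by (simp add: norm_mult)
qed

lemma norm_first_row_K: "\<kappa> \<in> K_group \<Longrightarrow> norm (first_row \<kappa>) = 1"
  by (auto simp: K_group_def first_row_k_rot)

text \<open>Since \<open>e\<^bsup>H(y)\<^esup>\<close> and \<open>K(y)\<^sup>-\<^sup>1\<close> are modulus and phase of the first column of \<open>y\<close>, the action on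
  a character is a power of the modulus times a power of the phase of \<open>\<alpha> w + \<beta> w\<^sup>-\<^sup>1\<close>, \<open>|w| = 1\<close>.\<close>
lemma principal_series_e_char:
  fixes k n :: int
  assumes x: "x \<in> SL2" and \<kappa>: "\<kappa> \<in> K_group"
  defines "z \<equiv> cayley_diag x * first_row \<kappa> + cayley_off x * cnj (first_row \<kappa>)"
  shows "principal_series (\<i> * of_int \<bar>k\<bar>) x (e_char n) \<kappa> =
           of_real (inverse (norm z ^ Suc (nat \<bar>k\<bar>))) * sgn z powi n"
proof -
  define y where "y = matrix_inv x ** matrix_inv \<kappa>"
  have y: "y \<in> SL2" unfolding y_def
    using x \<kappa> K_group_subset_SL2 by (blast intro: SL2_mult SL2_matrix_inv)
  have z: "first_col y = z" unfolding y_def z_def by (rule first_col_inv_mult_inv[OF x \<kappa>])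
  have "z \<noteq> 0" unfolding z_def using cayley_orbit_nonzero[OF x norm_first_row_K[OF \<kappa>]] .
  then have "norm z > 0" by simp
  have "exp ((\<i> * (\<i> * of_int \<bar>k\<bar>) - 1) * of_real (ln (norm z)))
      = of_real (exp (- (real (Suc (nat \<bar>k\<bar>)) * ln (norm z))))"
    unfolding exp_of_real[symmetric] by (rule arg_cong[of _ _ exp]) (simp add: algebra_simps complex_eq_iff)
  also have "exp (- (real (Suc (nat \<bar>k\<bar>)) * ln (norm z))) = inverse (norm z ^ Suc (nat \<bar>k\<bar>))"
    using \<open>norm z > 0\<close> by (simp only: exp_minus exp_of_nat_mult exp_ln)
  finally show ?thesis
    unfolding principal_series_def Let_def y_def[symmetric]
    by (simp only: iwasawa_H_eq[OF y] e_char_inv_iwasawa_K[OF y] z)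
qed

section \<open>Fourier coefficients on the circle\<close>

abbreviation circle_measure :: "real measure" where
  "circle_measure \<equiv> uniform_measure lborel {0..<2 * pi}"

lemma emeasure_circle_measure_UNIV: "emeasure circle_measure UNIV = 1"
  by (subst emeasure_uniform_measure) (auto intro!: ennreal_divide_self)

lemma finite_measure_circle: "finite_measure circle_measure"
  by (rule finite_measureI) (simp add: emeasure_circle_measure_UNIV del: emeasure_uniform_measure)

text \<open>Passing to the closed interval makes the fundamental theorem of calculus applicable.\<close>
lemma integral_circle_measure:
  fixes f :: "real \<Rightarrow> complex"
  assumes "continuous_on UNIV f"
  shows "(\<integral>\<theta>. f \<theta> \<partial>circle_measure) = (\<integral>\<theta>. indicator {0..2*pi} \<theta> *\<^sub>R f \<theta> \<partial>lborel) / of_real (2 * pi)"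
proof -
  have [measurable]: "f \<in> borel_measurable borel"
    using assms by (rule borel_measurable_continuous_onI)
  have "circle_measure = density lborel (\<lambda>\<theta>. ennreal (indicator {0..<2*pi} \<theta> / (2 * pi)))"
    unfolding uniform_measure_def
    by (intro density_cong) (auto simp: divide_ennreal[symmetric] split: split_indicator simp flip: ennreal_1)
  then have "(\<integral>\<theta>. f \<theta> \<partial>circle_measure) = (\<integral>\<theta>. (indicator {0..<2*pi} \<theta> / (2 * pi)) *\<^sub>R f \<theta> \<partial>lborel)"
    by (simp add: integral_density)
  also have "\<dots> = (\<integral>\<theta>. (indicator {0..2*pi} \<theta> *\<^sub>R f \<theta>) / of_real (2 * pi) \<partial>lborel)"
  proof (rule integral_cong_AE)
    have "AE \<theta> in lborel. \<theta> \<noteq> 2 * pi" by (rule AE_lborel_singleton)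
    then show "AE \<theta> in lborel. (indicator {0..<2*pi} \<theta> / (2 * pi)) *\<^sub>R f \<theta> = (indicator {0..2*pi} \<theta> *\<^sub>R f \<theta>) / of_real (2 * pi)"
      by eventually_elim (auto split: split_indicator simp: scaleR_conv_of_real)
  qed measurable
  finally show ?thesis by simp
qed

lemma integral_circle_cis:
  fixes m :: int
  shows "(\<integral>\<theta>. cis (of_int m * \<theta>) \<partial>circle_measure) = (if m = 0 then 1 else 0)"
proof -
  have *: "(\<integral>\<theta>. indicator {0..2*pi} \<theta> *\<^sub>R cis (of_int m * \<theta>) \<partial>lborel) = (if m = 0 then of_real (2 * pi) else 0)"
  proof (cases "m = 0")
    case True
    then show ?thesis by (simp add: scaleR_conv_of_real)
  next
    case False
    have "(\<integral>\<theta>. indicator {0..2*pi} \<theta> *\<^sub>R cis (of_int m * \<theta>) \<partial>lborel) =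
       cis (of_int m * (2 * pi)) / (\<i> * of_int m) - cis (of_int m * 0) / (\<i> * of_int m)"
    proof (rule integral_FTC_atLeastAtMost)
      fix \<theta> :: real
      show "((\<lambda>\<theta>. cis (of_int m * \<theta>) / (\<i> * of_int m)) has_vector_derivative cis (of_int m * \<theta>)) (at \<theta> within {0..2*pi})"
      proof -
        have "((\<lambda>z. exp (\<i> * of_int m * z) / (\<i> * of_int m)) has_field_derivative exp (\<i> * of_int m * of_real \<theta>)) (at (of_real \<theta>))"
          using False by (auto intro!: derivative_eq_intros)
        from has_vector_derivative_real_field[OF this] show ?thesis
          by (simp add: cis_conv_exp mult_ac)
      qed
    qed (auto intro!: continuous_intros)
    also have "cis (of_int m * (2 * pi)) = 1"
      using cis_multiple_2pi[of "of_int m"] by (simp add: mult_ac)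
    finally show ?thesis using False by simp
  qed
  show ?thesis
    by (subst integral_circle_measure) (auto intro!: continuous_intros simp: *)
qed

lemma k_rot_decomp: "k_rot \<theta> = cos \<theta> *\<^sub>R mat 1 + sin \<theta> *\<^sub>R vector [vector [0, 1], vector [-1, 0]]"
  by (simp add: k_rot_def matrix_eq_2_iff mat_def)

lemma measurable_k_rot[measurable]: "k_rot \<in> borel \<rightarrow>\<^sub>M restrict_space borel K_group"
proof (rule measurable_restrict_space2)
  show "k_rot \<in> borel \<rightarrow>\<^sub>M borel"
    unfolding k_rot_decomp[abs_def]
    by (intro borel_measurable_continuous_onI continuous_intros)
qed (auto simp: K_group_def)

lemma integral_haar_K:
  fixes f :: "real^2^2 \<Rightarrow> complex"
  assumes "continuous_on K_group f"
  shows "(\<integral>\<kappa>. f \<kappa> \<partial>haar_K) = (\<integral>\<theta>. f (k_rot \<theta>) \<partial>circle_measure)"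
  unfolding haar_K_def
proof (rule integral_distr)
  show "k_rot \<in> circle_measure \<rightarrow>\<^sub>M restrict_space borel K_group"
    using measurable_k_rot by (simp cong: measurable_cong_sets)
  show "f \<in> borel_measurable (restrict_space borel K_group)"
    using assms by (rule borel_measurable_continuous_on_restrict)
qed

lemma continuous_on_e_char: "continuous_on K_group (e_char n)"
  unfolding e_char_def[abs_def]
  by (intro continuous_intros) (use norm_first_row_K in force)

lemma e_char_cis: "e_char n (k_rot \<theta>) = cis (of_int n * \<theta>)"
  by (simp add: e_char_k_rot cis_conv_exp mult_ac)

lemma fourier_K_eq:
  assumes "continuous_on K_group f"
  shows "fourier_K f m = (\<integral>\<theta>. f (k_rot \<theta>) * cis (- (of_int m * \<theta>)) \<partial>circle_measure)"
  unfolding fourier_K_def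
  by (subst integral_haar_K) (auto intro!: continuous_intros assms continuous_on_e_char simp: e_char_cis cis_cnj)

lemma fourier_K_e_char: "fourier_K (e_char n) m = (if m = n then 1 else 0)"
proof -
  have "cis (of_int n * \<theta>) * cis (- (of_int m * \<theta>)) = cis (of_int (n - m) * \<theta>)" for \<theta>
    by (simp add: cis_mult algebra_simps)
  then show ?thesis
    by (simp add: fourier_K_eq continuous_on_e_char e_char_cis integral_circle_cis del: of_int_diff)
qed

section \<open>Matrix coefficients as Fourier coefficients\<close>

text \<open>The parameter \<open>j\<close> counts the steps of the \<open>K\<close>-type \<open>n\<close> above the extremal type \<open>|k| + 1\<close>.\<close>
lemma Z_types_abs:
  assumes "n \<in> Z_types k"
  obtains j where "\<bar>n\<bar> = int (2 * j + nat \<bar>k\<bar> + 1)"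
proof
  show "\<bar>n\<bar> = int (2 * nat ((\<bar>n\<bar> - \<bar>k\<bar> - 1) div 2) + nat \<bar>k\<bar> + 1)"
    using assms unfolding Z_types_def by (auto split: if_splits)
qed

lemma ds_weight_pos:
  assumes "n \<in> Z_types k"
  shows "ds_weight k n > 0"
proof -
  obtain j where "\<bar>n\<bar> = int (2 * j + nat \<bar>k\<bar> + 1)" using Z_types_abs[OF assms] .
  then have "nat ((\<bar>n\<bar> + \<bar>k\<bar> - 1) div 2) = j + nat \<bar>k\<bar>" by simp
  then show ?thesis by (simp add: ds_weight_def)
qed

text \<open>By orthogonality of the characters only the summand \<open>m = n\<close> survives.\<close>
lemma ds_inner_e_char:
  assumes "n \<in> Z_types k"
  shows "ds_inner k f (\<lambda>\<kappa>. e_char n \<kappa> / c) = of_real (ds_weight k n) * fourier_K f n / cnj c"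
proof -
  have "fourier_K (\<lambda>\<kappa>. e_char n \<kappa> / c) m = fourier_K (e_char n) m / c" for m
    unfolding fourier_K_def by (simp flip: integral_divide_zero)
  then have "ds_inner k f (\<lambda>\<kappa>. e_char n \<kappa> / c) =
      (\<Sum>\<^sub>\<infinity>m\<in>{n}. of_real (ds_weight k m) * fourier_K f m * cnj (fourier_K (e_char n) m / c))"
    unfolding ds_inner_def by (intro infsum_cong_neutral) (use assms in \<open>auto simp: fourier_K_e_char\<close>)
  then show ?thesis by (simp add: fourier_K_e_char)
qed

text \<open>The weight of the invariant inner product at \<open>n\<close> cancels against the normalisation of the basis
  vector, so the canonical diagonal coefficient is an ordinary Fourier coefficient.\<close>
lemma ds_coeff_eq_fourier_K:
  assumes "n \<in> Z_types k"
  shows "ds_coeff k n x = fourier_K (principal_series (\<i> * of_int \<bar>k\<bar>) x (e_char n)) n"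
proof -
  define c where "c = sqrt (ds_weight k n)"
  have c: "c > 0" "c^2 = ds_weight k n" using ds_weight_pos[OF assms] by (simp_all add: c_def)
  have "ds_inner k (e_char n) (e_char n) = of_real (ds_weight k n)"
    using ds_inner_e_char[OF assms, of "e_char n" 1] by (simp add: fourier_K_e_char)
  then have b: "ds_basis k n = (\<lambda>\<kappa>. e_char n \<kappa> / of_real c)" by (simp add: ds_basis_def c_def)
  have div: "fourier_K (\<lambda>\<kappa>. f \<kappa> / of_real c) m = fourier_K f m / of_real c" for f m
    unfolding fourier_K_def by (simp flip: integral_divide_zero)
  have "(\<lambda>\<kappa>. e_char n \<kappa> / of_real c) \<in> ds_space k"
    unfolding ds_space_def using assms c
    by (auto intro!: continuous_intros continuous_on_e_char simp: div fourier_K_e_char)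
  then have "discrete_series k x (\<lambda>\<kappa>. e_char n \<kappa> / of_real c) =
       (\<lambda>\<kappa>. principal_series (\<i> * of_int \<bar>k\<bar>) x (e_char n) \<kappa> / of_real c)"
    by (simp add: discrete_series_def fun_eq_iff principal_series_def Let_def)
  then have "ds_coeff k n x = of_real (ds_weight k n) * (fourier_K (principal_series (\<i> * of_int \<bar>k\<bar>) x (e_char n)) n / of_real c) / of_real c"
    unfolding ds_coeff_def b by (simp add: ds_inner_e_char[OF assms] div)
  then show ?thesis using c by (simp add: field_simps power2_eq_square flip: c(2))
qed

lemma ds_coeff_integral:
  assumes "n \<in> Z_types k" "x \<in> SL2"
  defines "z \<equiv> \<lambda>\<theta>. cayley_diag x * cis \<theta> + cayley_off x * cis (- \<theta>)"
  shows "ds_coeff k n x = (\<integral>\<theta>. of_real (inverse (norm (z \<theta>) ^ Suc (nat \<bar>k\<bar>))) * sgn (z \<theta>) powi n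
                               * cis (- (of_int n * \<theta>)) \<partial>circle_measure)"
proof -
  \<comment> \<open>Continuity supplies the measurability needed to pull the integral back to the angle.\<close>
  have c: "continuous_on K_group (principal_series (\<i> * of_int \<bar>k\<bar>) x (e_char n))"
  proof (subst continuous_on_cong[OF refl principal_series_e_char[OF assms(2)]])
    define f where "f \<kappa> = cayley_diag x * first_row \<kappa> + cayley_off x * cnj (first_row \<kappa>)" for \<kappa>
    have f: "continuous_on K_group f" "\<And>\<kappa>. \<kappa> \<in> K_group \<Longrightarrow> f \<kappa> \<noteq> 0"
      unfolding f_def[abs_def]
      by (auto intro!: continuous_intros simp: cayley_orbit_nonzero[OF assms(2)] norm_first_row_K)
    have "continuous_on K_group (\<lambda>\<kappa>. of_real (inverse (norm (f \<kappa>) ^ Suc (nat \<bar>k\<bar>))) * (f \<kappa> / of_real (norm (f \<kappa>))) powi n)"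
      using f(2) by (intro continuous_intros f) auto
    then show "continuous_on K_group (\<lambda>\<kappa>. of_real (inverse (norm (cayley_diag x * first_row \<kappa> + cayley_off x * cnj (first_row \<kappa>)) ^ Suc (nat \<bar>k\<bar>)))
         * sgn (cayley_diag x * first_row \<kappa> + cayley_off x * cnj (first_row \<kappa>)) powi n)"
      unfolding f_def[symmetric] by (simp add: sgn_eq)
  qed
  have "k_rot \<theta> \<in> K_group" for \<theta> by (simp add: K_group_def)
  then show ?thesis
    unfolding ds_coeff_eq_fourier_K[OF assms(1)] fourier_K_eq[OF c] z_def
    by (simp add: principal_series_e_char[OF assms(2)] first_row_k_rot cis_cnj)
qed

section \<open>Evaluation of the diagonal coefficients\<close>

text \<open>The Jacobi polynomial \<open>P\<^sub>j\<^bsup>(0,l)\<^esup>(1 - 2s)\<close>, that is the hypergeometric polynomial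
  \<open>\<^sub>2F\<^sub>1(-j, j+l+1; 1; s)\<close>. It is written with generalised binomial coefficients because that is the
  form in which it arises as a coefficient of a product of two binomial series.\<close>
definition ds_poly :: "nat \<Rightarrow> nat \<Rightarrow> real \<Rightarrow> real" where
  "ds_poly j l s = (\<Sum>i\<le>j. (of_nat j gchoose i) * ((- of_nat (j + l + 1)) gchoose (j - i)) * s ^ (j - i))"

text \<open>The point \<open>s = 1\<close> corresponds to infinity in the group, so this nonzero value is what makes the
  decay rate of the matrix coefficients exact. It is an instance of the Vandermonde convolution.\<close>
lemma ds_poly_1: "ds_poly j l 1 = (- 1) ^ j * of_nat ((l + j) choose j)"
proof -
  have "ds_poly j l 1 = (of_nat j + - of_nat (j + l + 1)) gchoose j"
    unfolding ds_poly_def by (simp only: gbinomial_Vandermonde[symmetric] atMost_atLeast0 power_one mult_1_right)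
  also have "(of_nat j + - of_nat (j + l + 1) :: real) = - of_nat (l + 1)" by simp
  also have "(\<dots> gchoose j) = (- 1) ^ j * ((of_nat (l + j) :: real) gchoose j)"
    by (subst gbinomial_minus) simp
  finally show ?thesis by (simp add: binomial_gbinomial)
qed

lemma integrable_circle_continuous:
  fixes f :: "real \<Rightarrow> complex"
  assumes "continuous_on UNIV f" "\<And>\<theta>. norm (f \<theta>) \<le> B"
  shows "integrable circle_measure f"
proof (rule finite_measure.integrable_const_bound[OF finite_measure_circle, of _ B])
  show "f \<in> borel_measurable circle_measure"
    using borel_measurable_continuous_onI[OF assms(1)] by (simp cong: measurable_cong_sets)
qed (simp add: assms(2))

lemma circle_measure_UNIV: "measure circle_measure UNIV = 1"
  by (simp add: measure_def emeasure_circle_measure_UNIV del: emeasure_uniform_measure measure_uniform_measure)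

lemma
  fixes a :: "nat \<Rightarrow> complex" and d :: nat
  assumes "summable (\<lambda>r. norm (a r))"
  shows integrable_circle_power_series:
      "integrable circle_measure (\<lambda>\<theta>. (\<Sum>r. a r * cis (2 * \<theta>) ^ r) * cis (- (2 * of_nat d * \<theta>)))" (is ?I)
    and integral_circle_power_series:
      "(\<integral>\<theta>. (\<Sum>r. a r * cis (2 * \<theta>) ^ r) * cis (- (2 * of_nat d * \<theta>)) \<partial>circle_measure) = a d" (is ?E)
proof -
  \<comment> \<open>Each term is a character, and integration is termwise by absolute convergence.\<close>
  define f where "f r \<theta> = a r * cis (of_int (2 * (int r - int d)) * \<theta>)" for r \<theta>
  have nf: "norm (f r \<theta>) = norm (a r)" for r \<theta> by (simp add: f_def norm_mult)
  have int: "integrable circle_measure (f r)" for r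
    by (rule integrable_circle_continuous[where B = "norm (a r)"])
       (auto simp: f_def norm_mult intro!: continuous_intros)
  have "summable (\<lambda>r. a r * cis (2 * \<theta>) ^ r)" for \<theta>
    by (rule summable_norm_cancel) (simp add: norm_mult norm_power assms)
  moreover have "a r * cis (2 * \<theta>) ^ r * cis (- (2 * of_nat d * \<theta>)) = f r \<theta>" for r \<theta>
  proof -
    have "cis (2 * \<theta>) ^ r * cis (- (2 * of_nat d * \<theta>)) = cis (of_int (2 * (int r - int d)) * \<theta>)"
      unfolding Complex.DeMoivre cis_mult by (rule arg_cong[of _ _ cis]) (simp add: algebra_simps)
    then show ?thesis by (simp add: f_def mult.assoc)
  qed
  ultimately have eq: "(\<Sum>r. a r * cis (2 * \<theta>) ^ r) * cis (- (2 * of_nat d * \<theta>)) = (\<Sum>r. f r \<theta>)" for \<theta>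
    by (simp add: suminf_mult2)
  have s: "summable (\<lambda>r. \<integral>\<theta>. norm (f r \<theta>) \<partial>circle_measure)"
    using assms by (simp add: nf circle_measure_UNIV del: measure_uniform_measure)
  have ae: "AE \<theta> in circle_measure. summable (\<lambda>r. norm (f r \<theta>))"
    using assms by (simp add: nf)
  show ?I unfolding eq by (rule integrable_suminf[OF int ae s])
  have "(\<lambda>r. integral\<^sup>L circle_measure (f r)) sums (\<integral>\<theta>. (\<Sum>r. f r \<theta>) \<partial>circle_measure)"
    by (rule sums_integral[OF int ae s])
  moreover have "integral\<^sup>L circle_measure (f r) = (if r = d then a r else 0)" for r
    unfolding f_def by (simp add: integral_circle_cis del: of_int_mult of_int_diff)
  ultimately show ?E
    unfolding eq using sums_unique2[OF _ sums_single[of d a]] by simp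
qed

lemma negative_binomial_sums:
  fixes z :: complex
  assumes "norm z < 1"
  shows "(\<lambda>r. ((- of_nat m) gchoose r) * z ^ r) sums inverse ((1 + z) ^ m)"
    and "summable (\<lambda>r. norm (((- of_nat m) gchoose r) * z ^ r))"
proof -
  have "1 + z \<noteq> 0" using assms by (metis add_eq_0_iff norm_minus_cancel norm_one less_irrefl)
  then have "(1 + z) powr (- of_nat m) = inverse ((1 + z) ^ m)"
    by (simp add: powr_minus powr_nat)
  then show "(\<lambda>r. ((- of_nat m) gchoose r) * z ^ r) sums inverse ((1 + z) ^ m)"
    using gen_binomial_complex[OF assms, of "- of_nat m"] by simp
  have "1 \<le> conv_radius (\<lambda>r. (- of_nat m :: complex) gchoose r)" by (simp add: conv_radius_gchoose)
  then show "summable (\<lambda>r. norm (((- of_nat m) gchoose r) * z ^ r))"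
    using assms by (intro abs_summable_in_conv_radius) (auto intro: less_le_trans[of _ 1])
qed

lemma of_real_gbinomial:
  "of_real (a gchoose r) = (of_real a gchoose r :: 'a::{real_div_algebra, field_char_0})"
  by (simp add: gbinomial_prod_rev)

text \<open>With \<open>w = e\<^bsup>i\<theta>\<^esup>\<close>, \<open>u = w\<^sup>2\<close> and \<open>m = j+l+1\<close>, the integrand equals
  \<open>z\<^sup>j (cnj z)\<^bsup>-m\<^esup> w\<^bsup>-(j+m)\<^esup>\<close>, where \<open>z = w (\<alpha> + \<beta> u\<^sup>-\<^sup>1)\<close> and \<open>cnj z = w\<^sup>-\<^sup>1 cnj \<alpha> (1 + q u)\<close> with
  \<open>q = cnj \<beta> / cnj \<alpha>\<close>. All factors \<open>w\<close> cancel and there remains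
  \<open>(cnj \<alpha>)\<^bsup>-m\<^esup> (\<alpha> + \<beta> u\<^sup>-\<^sup>1)\<^sup>j (1 + q u)\<^bsup>-m\<^esup>\<close>. As \<open>|q| < 1\<close>, the last factor is an absolutely
  convergent binomial series in \<open>u\<close>, and the constant term of the product is a finite sum.\<close>
lemma discrete_series_circle_integral:
  fixes \<alpha> \<beta> :: complex and j l :: nat
  assumes "norm \<beta> < norm \<alpha>"
  defines "z \<equiv> \<lambda>\<theta>. \<alpha> * cis \<theta> + \<beta> * cis (- \<theta>)"
  shows "(\<integral>\<theta>. of_real (inverse (norm (z \<theta>) ^ Suc l)) * sgn (z \<theta>) ^ (2 * j + l + 1)
            * cis (- (of_nat (2 * j + l + 1) * \<theta>)) \<partial>circle_measure)
       = \<alpha> ^ j / cnj \<alpha> ^ (j + l + 1) * of_real (ds_poly j l ((norm \<beta> / norm \<alpha>)\<^sup>2))"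
    (is "(\<integral>\<theta>. ?g \<theta> \<partial>_) = _")
proof -
  define m where "m = j + l + 1"
  define q where "q = cnj \<beta> / cnj \<alpha>"
  have \<alpha>: "\<alpha> \<noteq> 0" using assms by auto
  have q: "norm q < 1" using assms \<alpha> by (simp add: q_def norm_divide)
  define a where "a r = (((- of_nat m) gchoose r) * q ^ r :: complex)" for r
  define c where "c i = (of_nat (j choose i) * \<alpha> ^ i * \<beta> ^ (j - i) / cnj \<alpha> ^ m)" for i
  have sa: "summable (\<lambda>r. norm (a r))" unfolding a_def by (rule negative_binomial_sums(2)[OF q])
  have g: "?g \<theta> = (\<Sum>i\<le>j. c i * ((\<Sum>r. a r * cis (2 * \<theta>) ^ r) * cis (- (2 * of_nat (j - i) * \<theta>))))" for \<theta>
  proof -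
    define w where "w = cis \<theta>"
    define G where "G = ?g \<theta>"
    have w: "w \<noteq> 0" "cnj w = inverse w" "cis (- \<theta>) = inverse w" by (simp_all add: w_def cis_cnj cis_inverse)
    have zw: "z \<theta> = \<alpha> * w + \<beta> * cnj w" by (simp add: z_def w_def cis_cnj)
    have z0: "z \<theta> \<noteq> 0"
    proof
      assume "z \<theta> = 0"
      then have "norm (\<alpha> * w) = norm (\<beta> * cnj w)" unfolding zw by (metis add_eq_0_iff norm_minus_cancel)
      then show False using assms by (simp add: norm_mult w_def)
    qed
    have cz: "cnj (z \<theta>) = cnj \<alpha> * inverse w * (1 + q * w\<^sup>2)"
      using \<alpha> w by (simp add: zw q_def field_simps power2_eq_square)
    have e: "2 * m = Suc l + (2 * j + l + 1)" by (simp add: m_def)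
    have "of_real (inverse (norm (z \<theta>) ^ Suc l)) * sgn (z \<theta>) ^ (2 * j + l + 1) =
        z \<theta> ^ (2 * j + l + 1) / of_real (norm (z \<theta>)) ^ (2 * m)"
      unfolding e power_add[of _ "Suc l"] sgn_eq power_divide of_real_inverse of_real_power
      by (simp only: divide_inverse inverse_mult_distrib mult_ac)
    then have "G = z \<theta> ^ (2 * j + l + 1) / of_real (norm (z \<theta>)) ^ (2 * m) * cis (- (of_nat (2 * j + l + 1) * \<theta>))"
      unfolding G_def by (simp only:)
    also have "of_real (norm (z \<theta>)) ^ (2 * m) = (z \<theta> * cnj (z \<theta>)) ^ m"
      by (simp only: power_mult complex_norm_square flip: of_real_power)
    also have "z \<theta> ^ (2 * j + l + 1) = z \<theta> ^ j * z \<theta> ^ m" by (simp add: m_def mult_2 add.assoc flip: power_add)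
    also have "cis (- (of_nat (2 * j + l + 1) * \<theta>)) = inverse w ^ (j + m)"
      unfolding w_def cis_inverse Complex.DeMoivre
      by (rule arg_cong[of _ _ cis]) (simp add: m_def algebra_simps)
    also have "z \<theta> ^ j * z \<theta> ^ m / (z \<theta> * cnj (z \<theta>)) ^ m * inverse w ^ (j + m) =
        (z \<theta> * inverse w) ^ j * (inverse w / cnj (z \<theta>)) ^ m"
      using z0 by (simp add: power_mult_distrib power_divide power_add field_simps)
    also have "inverse w / cnj (z \<theta>) = inverse (cnj \<alpha>) * inverse (1 + q * w\<^sup>2)"
      unfolding cz using w by (simp add: field_simps)
    also have "z \<theta> * inverse w = \<alpha> + \<beta> * inverse w ^ 2"
      using w by (simp add: zw field_simps power2_eq_square)
    also have "(inverse (cnj \<alpha>) * inverse (1 + q * w\<^sup>2)) ^ m = inverse ((1 + q * w\<^sup>2) ^ m) / cnj \<alpha> ^ m"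
      by (simp add: power_mult_distrib power_inverse divide_inverse)
    also have "inverse ((1 + q * w\<^sup>2) ^ m) = (\<Sum>r. a r * cis (2 * \<theta>) ^ r)"
    proof -
      have "norm (q * w\<^sup>2) < 1" using q by (simp add: norm_mult norm_power w_def)
      from sums_unique[OF negative_binomial_sums(1)[OF this, of m]] show ?thesis
        by (simp add: a_def power_mult_distrib mult.assoc w_def Complex.DeMoivre flip: power_mult)
    qed
    also have "(\<alpha> + \<beta> * inverse w ^ 2) ^ j = (\<Sum>i\<le>j. of_nat (j choose i) * \<alpha> ^ i * \<beta> ^ (j - i) * cis (- (2 * of_nat (j - i) * \<theta>)))"
      by (simp add: binomial_ring power_mult_distrib w_def cis_inverse Complex.DeMoivre mult_ac flip: power_mult)
    finally show ?thesis
      unfolding G_def[symmetric] by (simp add: c_def sum_distrib_right sum_distrib_left mult_ac)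
  qed
  have "(\<integral>\<theta>. ?g \<theta> \<partial>circle_measure) = (\<Sum>i\<le>j. \<integral>\<theta>. c i *
      ((\<Sum>r. a r * cis (2 * \<theta>) ^ r) * cis (- (2 * of_nat (j - i) * \<theta>))) \<partial>circle_measure)"
    unfolding g
    by (intro Bochner_Integration.integral_sum integrable_mult_right integrable_circle_power_series sa)
  also have "\<dots> = (\<Sum>i\<le>j. c i * a (j - i))"
    by (simp only: Bochner_Integration.integral_mult_right_zero integral_circle_power_series[OF sa])
  also have "\<dots> = (\<Sum>i\<le>j. \<alpha> ^ j / cnj \<alpha> ^ m * of_real ((of_nat j gchoose i) * ((- of_nat m) gchoose (j - i)) * ((norm \<beta> / norm \<alpha>)\<^sup>2) ^ (j - i)))"
  proof (intro sum.cong refl)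
    fix i assume i: "i \<in> {..j}"
    have *: "(\<beta> * q) ^ (j - i) = \<alpha> ^ (j - i) * of_real (((norm \<beta> / norm \<alpha>)\<^sup>2) ^ (j - i))"
    proof -
      have "of_real ((norm \<beta> / norm \<alpha>)\<^sup>2) = (\<beta> * cnj \<beta>) / (\<alpha> * cnj \<alpha>)"
        by (simp only: power_divide of_real_divide complex_norm_square)
      then have "\<beta> * q = \<alpha> * of_real ((norm \<beta> / norm \<alpha>)\<^sup>2)"
        using \<alpha> by (simp add: q_def)
      then show ?thesis by (simp add: power_mult_distrib)
    qed
    have "c i * a (j - i) = of_nat (j choose i) * ((- of_nat m) gchoose (j - i)) * \<alpha> ^ i * (\<beta> * q) ^ (j - i) / cnj \<alpha> ^ m"
      by (simp add: c_def a_def power_mult_distrib)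
    also have "\<dots> = of_nat (j choose i) * ((- of_nat m) gchoose (j - i)) * \<alpha> ^ j / cnj \<alpha> ^ m * of_real (((norm \<beta> / norm \<alpha>)\<^sup>2) ^ (j - i))"
    proof -
      have "\<alpha> ^ j = \<alpha> ^ i * \<alpha> ^ (j - i)" using i by (simp flip: power_add)
      then show ?thesis unfolding * by simp
    qed
    finally show "c i * a (j - i) = \<alpha> ^ j / cnj \<alpha> ^ m * of_real ((of_nat j gchoose i) * ((- of_nat m) gchoose (j - i)) * ((norm \<beta> / norm \<alpha>)\<^sup>2) ^ (j - i))"
      by (simp add: binomial_gbinomial of_real_gbinomial mult_ac)
  qed
  also have "\<dots> = \<alpha> ^ j / cnj \<alpha> ^ m * of_real (ds_poly j l ((norm \<beta> / norm \<alpha>)\<^sup>2))"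
    by (simp add: ds_poly_def m_def sum_distrib_left)
  finally show ?thesis unfolding m_def .
qed

text \<open>A negative \<open>K\<close>-type conjugates the integrand of the corresponding positive one.\<close>
lemma ds_coeff_formula:
  assumes n: "n \<in> Z_types k" and j: "\<bar>n\<bar> = int (2 * j + nat \<bar>k\<bar> + 1)" and x: "x \<in> SL2"
  shows "ds_coeff k n x =
    (if n > 0 then cayley_diag x ^ j / cnj (cayley_diag x) ^ (j + nat \<bar>k\<bar> + 1)
     else cnj (cayley_diag x) ^ j / cayley_diag x ^ (j + nat \<bar>k\<bar> + 1))
    * of_real (ds_poly j (nat \<bar>k\<bar>) ((norm (cayley_off x) / norm (cayley_diag x))\<^sup>2))"
proof -
  let ?l = "nat \<bar>k\<bar>"
  let ?z = "\<lambda>\<theta>. cayley_diag x * cis \<theta> + cayley_off x * cis (- \<theta>)"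
  let ?g = "\<lambda>\<theta>. of_real (inverse (norm (?z \<theta>) ^ Suc ?l)) * sgn (?z \<theta>) ^ (2 * j + ?l + 1)
            * cis (- (of_nat (2 * j + ?l + 1) * \<theta>))"
  note I = discrete_series_circle_integral[OF cayley_off_less_diag[OF x], of ?l j]
  show ?thesis
  proof (cases "n > 0")
    case True
    then have "n = int (2 * j + ?l + 1)" using j by simp
    have "ds_coeff k n x = (\<integral>\<theta>. ?g \<theta> \<partial>circle_measure)"
      unfolding ds_coeff_integral[OF n x] by (simp only: \<open>n = _\<close> power_int_of_nat of_int_of_nat_eq)
    then show ?thesis unfolding I using True by simp
  next
    case False
    then have n': "n = - int (2 * j + ?l + 1)" using j by simp
    have "ds_coeff k n x = (\<integral>\<theta>. cnj (?g \<theta>) \<partial>circle_measure)"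
      unfolding ds_coeff_integral[OF n x]
    proof (rule Bochner_Integration.integral_cong[OF refl])
      fix \<theta>
      have "?z \<theta> \<noteq> 0" using cayley_orbit_nonzero[OF x, of "cis \<theta>"] by (simp add: cis_cnj)
      then have "sgn (?z \<theta>) * cnj (sgn (?z \<theta>)) = 1"
        by (simp add: complex_norm_square[symmetric] norm_sgn)
      then have inv: "inverse (sgn (?z \<theta>)) = cnj (sgn (?z \<theta>))" by (rule inverse_unique)
      have "sgn (?z \<theta>) powi n = cnj (sgn (?z \<theta>)) ^ (2 * j + ?l + 1)"
        unfolding n' by (simp only: power_int_minus power_int_of_nat inv flip: power_inverse)
      moreover have "- (of_int n * \<theta>) = of_nat (2 * j + ?l + 1) * \<theta>"
        unfolding n' by (simp add: algebra_simps)
      ultimately show "of_real (inverse (norm (?z \<theta>) ^ Suc ?l)) * sgn (?z \<theta>) powi n * cis (- (of_int n * \<theta>)) = cnj (?g \<theta>)"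
        by (simp only: complex_cnj_mult complex_cnj_power complex_cnj_complex_of_real cis_cnj minus_minus)
    qed
    also have "\<dots> = cnj (\<integral>\<theta>. ?g \<theta> \<partial>circle_measure)" by (subst Bochner_Integration.integral_cnj) (rule refl)
    finally show ?thesis unfolding I using False by simp
  qed
qed

text \<open>Since \<open>|\<alpha>|\<^sup>2 - |\<beta>|\<^sup>2 = 1\<close>, the absolute value depends on \<open>|\<alpha>|\<close> alone. On \<open>K a\<^sub>t K\<close> this is
  \<open>cosh t\<close>, and the coefficient is \<open>cosh t\<^bsup>-(|k|+1)\<^esup>\<close> times a polynomial in \<open>tanh\<^sup>2 t\<close>.\<close>
lemma norm_ds_coeff:
  assumes n: "n \<in> Z_types k" and j: "\<bar>n\<bar> = int (2 * j + nat \<bar>k\<bar> + 1)" and x: "x \<in> SL2"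
  shows "norm (ds_coeff k n x) =
     \<bar>ds_poly j (nat \<bar>k\<bar>) (1 - 1 / norm (cayley_diag x) ^ 2)\<bar> / norm (cayley_diag x) ^ (nat \<bar>k\<bar> + 1)"
proof -
  let ?a = "norm (cayley_diag x)"
  have a: "?a \<noteq> 0" using cayley_off_less_diag[OF x] norm_ge_zero[of "cayley_off x"] by linarith
  have "(norm (cayley_off x) / ?a)\<^sup>2 = (?a ^ 2 - 1) / ?a ^ 2"
    using cayley_norm_diff[OF x] by (simp add: power_divide)
  also have "\<dots> = 1 - 1 / ?a ^ 2"
    using a by (simp add: diff_divide_distrib)
  finally have "(norm (cayley_off x) / ?a)\<^sup>2 = 1 - 1 / ?a ^ 2" .
  then show ?thesis
    unfolding ds_coeff_formula[OF assms] using a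
    by (simp only:) (auto simp: norm_mult norm_divide norm_power power_add)
qed

section \<open>Haar measure of bi-invariant sets\<close>

lemma cayley_diag_k_rot_mult: "cayley_diag (k_rot \<theta> ** x) = cis \<theta> * cayley_diag x"
  by (simp add: cayley_diag_def matrix_mult_2_entry k_rot_def complex_eq_iff field_simps)

lemma cayley_diag_mult_k_rot: "cayley_diag (x ** k_rot \<theta>) = cayley_diag x * cis \<theta>"
  by (simp add: cayley_diag_def matrix_mult_2_entry k_rot_def complex_eq_iff field_simps)

lemma norm_cayley_diag_cartan:
  assumes "\<kappa>\<^sub>1 \<in> K_group" "\<kappa>\<^sub>2 \<in> K_group"
  shows "norm (cayley_diag (\<kappa>\<^sub>1 ** a_diag t ** \<kappa>\<^sub>2)) = cosh t"
proof -
  have "cayley_diag (a_diag t) = of_real (cosh t)"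
    by (simp add: cayley_diag_def a_diag_def cosh_def complex_eq_iff)
  with assms show ?thesis
    by (auto simp: K_group_def cayley_diag_k_rot_mult cayley_diag_mult_k_rot norm_mult cosh_real_nonneg)
qed

lemma a_diag_in_SL2: "a_diag t \<in> SL2"
  by (simp add: SL2_def det_2 a_diag_def exp_minus)

lemma space_haar_K: "space haar_K = K_group"
  by (simp add: haar_K_def space_restrict_space)

lemma sets_haar_K: "sets haar_K = sets (restrict_space borel K_group)"
  by (simp add: haar_K_def)

lemma emeasure_haar_K_space: "emeasure haar_K K_group = 1"
proof -
  have k: "k_rot \<in> circle_measure \<rightarrow>\<^sub>M restrict_space borel K_group"
    using measurable_k_rot by (simp cong: measurable_cong_sets)
  have "K_group \<in> sets (restrict_space borel K_group)"
    using sets.top[of "restrict_space borel K_group"] by (simp add: space_restrict_space)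
  then have "emeasure haar_K K_group = emeasure circle_measure (k_rot -` K_group \<inter> space circle_measure)"
    unfolding haar_K_def by (subst emeasure_distr[OF k]) auto
  also have "k_rot -` K_group \<inter> space circle_measure = UNIV" by (auto simp: K_group_def)
  finally show ?thesis by (simp only: emeasure_circle_measure_UNIV)
qed

lemma sigma_finite_haar_K: "sigma_finite_measure haar_K"
proof -
  have "finite_measure haar_K"
    by (rule finite_measureI) (simp add: space_haar_K emeasure_haar_K_space)
  then show ?thesis by (rule finite_measure.axioms)
qed

abbreviation cartan_measure :: "real measure" where
  "cartan_measure \<equiv> density lborel (\<lambda>t. ennreal (2 * sinh (2 * t)) * indicator {0<..} t)"

lemma sinh_measurable [measurable]: "(sinh :: real \<Rightarrow> real) \<in> borel_measurable borel"
  by (intro borel_measurable_continuous_onI continuous_intros)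

lemma cosh_measurable [measurable]: "(cosh :: real \<Rightarrow> real) \<in> borel_measurable borel"
  by (intro borel_measurable_continuous_onI continuous_intros)

lemma sigma_finite_cartan_measure: "sigma_finite_measure cartan_measure"
  by (subst sigma_finite_measure.sigma_finite_iff_density_finite[OF sigma_finite_lborel]) (auto split: split_indicator)

lemma continuous_on_matrix_mult [continuous_intros]:
  fixes f g :: "'a::topological_space \<Rightarrow> real^2^2"
  assumes "continuous_on S f" "continuous_on S g"
  shows "continuous_on S (\<lambda>x. f x ** g x)"
  unfolding matrix_matrix_mult_def by (intro continuous_intros assms)

lemma matrix_mult_measurable [measurable]:
  fixes f g :: "'a \<Rightarrow> real^2^2"
  assumes "f \<in> borel_measurable M" "g \<in> borel_measurable M"
  shows "(\<lambda>x. f x ** g x) \<in> borel_measurable M"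
  by (rule borel_measurable_continuous_Pair[OF assms]) (intro continuous_intros)

lemma a_diag_measurable [measurable]: "a_diag \<in> borel_measurable borel"
proof -
  have "a_diag t = exp t *\<^sub>R vector [vector [1, 0], vector [0, 0]] + exp (- t) *\<^sub>R vector [vector [0, 0], vector [0, 1]]" for t
    by (simp add: a_diag_def matrix_eq_2_iff)
  then have "a_diag = (\<lambda>t. exp t *\<^sub>R vector [vector [1, 0], vector [0, 0]] + exp (- t) *\<^sub>R vector [vector [0, 0], vector [0, 1]])"
    by blast
  moreover have "\<dots> \<in> borel_measurable borel"
    by (intro borel_measurable_continuous_onI continuous_intros)
  ultimately show ?thesis by simp
qed

lemma id_haar_K_measurable [measurable]: "(\<lambda>\<kappa>. \<kappa>) \<in> haar_K \<rightarrow>\<^sub>M borel"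
  using measurable_restrict_space1[OF measurable_ident, of borel K_group]
  by (simp add: measurable_cong_sets[OF sets_haar_K refl] id_def)

lemma cartan_map_measurable:
  "(\<lambda>(\<kappa>\<^sub>1, t, \<kappa>\<^sub>2). \<kappa>\<^sub>1 ** a_diag t ** \<kappa>\<^sub>2) \<in> haar_K \<Otimes>\<^sub>M (cartan_measure \<Otimes>\<^sub>M haar_K) \<rightarrow>\<^sub>M restrict_space borel SL2"
proof (rule measurable_restrict_space2)
  show "(\<lambda>(\<kappa>\<^sub>1, t, \<kappa>\<^sub>2). \<kappa>\<^sub>1 ** a_diag t ** \<kappa>\<^sub>2) \<in> haar_K \<Otimes>\<^sub>M (cartan_measure \<Otimes>\<^sub>M haar_K) \<rightarrow>\<^sub>M borel"
  proof -
    have [measurable]: "(\<lambda>p. fst p) \<in> haar_K \<Otimes>\<^sub>M (cartan_measure \<Otimes>\<^sub>M haar_K) \<rightarrow>\<^sub>M borel"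
      by (rule measurable_compose[OF measurable_fst id_haar_K_measurable])
    have [measurable]: "(\<lambda>p. snd (snd p)) \<in> haar_K \<Otimes>\<^sub>M (cartan_measure \<Otimes>\<^sub>M haar_K) \<rightarrow>\<^sub>M borel"
      by (rule measurable_compose[OF measurable_snd measurable_compose[OF measurable_snd id_haar_K_measurable]])
    show ?thesis unfolding case_prod_beta by measurable
  qed
  show "(\<lambda>(\<kappa>\<^sub>1, t, \<kappa>\<^sub>2). \<kappa>\<^sub>1 ** a_diag t ** \<kappa>\<^sub>2) \<in> space (haar_K \<Otimes>\<^sub>M (cartan_measure \<Otimes>\<^sub>M haar_K)) \<rightarrow> SL2"
    using K_group_subset_SL2 by (auto simp: space_pair_measure space_haar_K intro!: SL2_mult a_diag_in_SL2)
qed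

lemma space_haar_SL2: "space haar_SL2 = SL2"
  by (simp add: haar_SL2_def space_restrict_space)

lemma continuous_on_cayley_diag: "continuous_on S cayley_diag"
  unfolding cayley_diag_def[abs_def] by (intro continuous_intros) auto

text \<open>The preimage under the Cartan map is a product set whose two factors in \<open>K\<close> have mass \<open>1\<close>.\<close>
lemma emeasure_haar_SL2_radial:
  fixes B :: "real set"
  assumes B: "B \<in> sets borel"
  shows "emeasure haar_SL2 {x \<in> SL2. norm (cayley_diag x) \<in> B} = emeasure cartan_measure {t. cosh t \<in> B}"
proof -
  let ?T = "\<lambda>(\<kappa>\<^sub>1, t, \<kappa>\<^sub>2). \<kappa>\<^sub>1 ** a_diag t ** \<kappa>\<^sub>2"
  let ?P = "haar_K \<Otimes>\<^sub>M (cartan_measure \<Otimes>\<^sub>M haar_K)"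
  interpret K: sigma_finite_measure haar_K by (rule sigma_finite_haar_K)
  interpret R: sigma_finite_measure cartan_measure by (rule sigma_finite_cartan_measure)
  interpret RK: pair_sigma_finite cartan_measure haar_K ..
  have A: "{t. cosh t \<in> B} \<in> sets cartan_measure"
    using measurable_sets[OF cosh_measurable B] by (simp add: vimage_def)
  have K: "K_group \<in> sets haar_K" using sets.top[of haar_K] by (simp add: space_haar_K)
  have "(\<lambda>x. norm (cayley_diag x)) \<in> borel_measurable (restrict_space borel SL2)"
    by (intro borel_measurable_continuous_on_restrict continuous_on_norm continuous_on_cayley_diag)
  from measurable_sets[OF this B]
  have S: "{x \<in> SL2. norm (cayley_diag x) \<in> B} \<in> sets (restrict_space borel SL2)"
    by (simp add: space_restrict_space vimage_def Int_def conj_commute)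
  have "emeasure haar_SL2 {x \<in> SL2. norm (cayley_diag x) \<in> B}
      = emeasure ?P (?T -` {x \<in> SL2. norm (cayley_diag x) \<in> B} \<inter> space ?P)"
    unfolding haar_SL2_def by (rule emeasure_distr[OF cartan_map_measurable S])
  also have "?T -` {x \<in> SL2. norm (cayley_diag x) \<in> B} \<inter> space ?P = K_group \<times> ({t. cosh t \<in> B} \<times> K_group)"
    using K_group_subset_SL2
    by (auto simp: space_pair_measure space_haar_K norm_cayley_diag_cartan intro!: SL2_mult a_diag_in_SL2)
  also have "emeasure ?P \<dots> = emeasure cartan_measure {t. cosh t \<in> B}"
    using A K by (simp add: RK.emeasure_pair_measure_Times K.emeasure_pair_measure_Times emeasure_haar_K_space del: emeasure_density)
  finally show ?thesis .
qed

lemma emeasure_cartan_cosh_less: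
  assumes "1 \<le> S"
  shows "emeasure cartan_measure {t. cosh t < S} = ennreal (2 * (S\<^sup>2 - 1))"
proof -
  define T where "T = arcosh S"
  have T: "0 \<le> T" "cosh T = S" using assms by (simp_all add: T_def)
  have A: "{t. cosh t < S} \<in> sets lborel" by measurable
  have ae: "AE t in lborel. t \<noteq> 0 \<and> t \<noteq> T"
    using AE_lborel_singleton[of 0] AE_lborel_singleton[of T] by eventually_elim auto
  have cl: "cosh t < S \<longleftrightarrow> t < T" if "0 < t" for t
    using that T by (metis cosh_real_nonneg_less_iff less_imp_le)
  have "emeasure cartan_measure {t. cosh t < S} =
      (\<integral>\<^sup>+t. (ennreal (2 * sinh (2 * t)) * indicator {0<..} t) * indicator {t. cosh t < S} t \<partial>lborel)"
    using A by (subst emeasure_density) auto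
  also have "\<dots> = (\<integral>\<^sup>+t. ennreal (2 * sinh (2 * t)) * indicator {0..T} t \<partial>lborel)"
    by (rule nn_integral_cong_AE) (use ae in eventually_elim, auto split: split_indicator simp: cl)
  also have "\<dots> = ennreal (cosh (2 * T) - cosh (2 * 0))"
    by (rule nn_integral_FTC_Icc) (use T in \<open>auto intro!: derivative_eq_intros\<close>)
  also have "cosh (2 * T) - cosh (2 * 0) = 2 * (S\<^sup>2 - 1)"
    using T by (simp add: cosh_double_cosh)
  finally show ?thesis .
qed

section \<open>Decay at infinity and Lorentz spaces\<close>

text \<open>A value above \<open>\<alpha>\<close> forces \<open>cosh t < S = (C/\<alpha>)\<^bsup>1/M\<^esup>\<close>, a set of measure \<open>2(S\<^sup>2 - 1)\<close> if \<open>S \<ge> 1\<close>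
  and empty otherwise.\<close>
lemma distribution_fun_le_of_decay:
  fixes f :: "real^2^2 \<Rightarrow> complex" and M :: nat
  assumes le: "\<And>x. x \<in> SL2 \<Longrightarrow> norm (f x) \<le> C / norm (cayley_diag x) ^ M"
    and "0 < C" "0 < M" "0 < \<alpha>"
  shows "distribution_fun haar_SL2 f \<alpha> \<le> (if \<alpha> < C then ennreal (2 * (C / \<alpha>) powr (2 / M)) else 0)"
proof -
  define S where "S = (C / \<alpha>) powr (1 / M)"
  have S: "S > 0" "S ^ M = C / \<alpha>" "S\<^sup>2 = (C / \<alpha>) powr (2 / M)"
    using assms by (simp_all add: S_def powr_realpow[symmetric] powr_powr)
  have sub: "norm (cayley_diag x) \<in> {..<S}" if "x \<in> SL2" "\<alpha> < norm (f x)" for x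
  proof -
    have "norm (cayley_diag x) > 0"
      using cayley_off_less_diag[OF that(1)] norm_ge_zero[of "cayley_off x"] by linarith
    moreover have "\<alpha> < C / norm (cayley_diag x) ^ M" using le[OF that(1)] that(2) by linarith
    ultimately have "norm (cayley_diag x) ^ M < S ^ M"
      using assms(4) by (simp add: S field_simps)
    then show ?thesis using S(1) by (auto intro: power_less_imp_less_base)
  qed
  have "distribution_fun haar_SL2 f \<alpha> \<le> emeasure haar_SL2 {x \<in> SL2. norm (cayley_diag x) \<in> {..<S}}"
    unfolding distribution_fun_def
  proof (rule emeasure_mono)
    show "{x \<in> space haar_SL2. \<alpha> < norm (f x)} \<subseteq> {x \<in> SL2. norm (cayley_diag x) \<in> {..<S}}"
      using sub by (auto simp: space_haar_SL2)
    have "(\<lambda>x. norm (cayley_diag x)) \<in> borel_measurable (restrict_space borel SL2)"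
      by (intro borel_measurable_continuous_on_restrict continuous_on_norm continuous_on_cayley_diag)
    from measurable_sets[OF this, of "{..<S}"]
    show "{x \<in> SL2. norm (cayley_diag x) \<in> {..<S}} \<in> sets haar_SL2"
      by (simp add: haar_SL2_def space_restrict_space vimage_def Int_def conj_commute)
  qed
  also have "\<dots> = emeasure cartan_measure {t. cosh t < S}"
    by (subst emeasure_haar_SL2_radial) (simp_all del: emeasure_density)
  also have "\<dots> \<le> (if \<alpha> < C then ennreal (2 * (C / \<alpha>) powr (2 / M)) else 0)"
  proof (cases "\<alpha> < C")
    case True
    then have "1 \<le> S" unfolding S_def using assms by (simp add: ge_one_powr_ge_zero)
    then show ?thesis using True
      by (subst emeasure_cartan_cosh_less) (auto simp flip: S(3) intro!: ennreal_leI)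
  next
    case False
    then have "S ^ M \<le> 1 ^ M" using assms by (simp add: S)
    then have "S \<le> 1" using \<open>0 < M\<close> power_strict_mono[of 1 S M] by (meson linorder_not_less zero_le_one)
    then have "{t. cosh t < S} = {}" using cosh_real_ge_1 by (auto simp: not_less intro: order_trans)
    then show ?thesis by simp
  qed
  finally show ?thesis .
qed

text \<open>Values above \<open>\<alpha>\<close> are guaranteed on the shell \<open>R \<le> cosh t < (c/\<alpha>)\<^bsup>1/M\<^esup>\<close>.\<close>
lemma distribution_fun_ge_of_decay:
  fixes f :: "real^2^2 \<Rightarrow> complex" and M :: nat
  assumes f: "f \<in> borel_measurable haar_SL2"
    and ge: "\<And>x. x \<in> SL2 \<Longrightarrow> R \<le> norm (cayley_diag x) \<Longrightarrow> c / norm (cayley_diag x) ^ M \<le> norm (f x)"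
    and "0 < c" "0 < M" "0 < \<alpha>" "1 \<le> R"
  shows "ennreal (2 * ((c / \<alpha>) powr (2 / M) - R\<^sup>2)) \<le> distribution_fun haar_SL2 f \<alpha>"
proof -
  define S where "S = (c / \<alpha>) powr (1 / M)"
  have S: "S > 0" "S ^ M = c / \<alpha>" "S\<^sup>2 = (c / \<alpha>) powr (2 / M)"
    using assms by (simp_all add: S_def powr_realpow[symmetric] powr_powr)
  show ?thesis
  proof (cases "R \<le> S")
    case False
    then have "S\<^sup>2 \<le> R\<^sup>2" using S by (intro power_mono) auto
    then show ?thesis by (simp add: ennreal_neg flip: S(3))
  next
    case True
    have sets: "{t. cosh t \<in> {R..<S}} \<in> sets cartan_measure" "{t. cosh t < R} \<in> sets cartan_measure"
      "{t. cosh t < S} \<in> sets cartan_measure" by simp_all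
    \<comment> \<open>The measure of the shell is obtained as a difference, both terms having finite measure.\<close>
    have "emeasure cartan_measure {t. cosh t < S} \<le> emeasure cartan_measure {t. cosh t < R} + emeasure cartan_measure {t. cosh t \<in> {R..<S}}"
      by (rule order_trans[OF emeasure_mono emeasure_subadditive]) (use sets in \<open>auto simp del: emeasure_density\<close>)
    then have "ennreal (2 * (S\<^sup>2 - 1)) \<le> ennreal (2 * (R\<^sup>2 - 1)) + emeasure cartan_measure {t. cosh t \<in> {R..<S}}"
      using True assms(6) by (simp add: emeasure_cartan_cosh_less del: emeasure_density)
    then have "ennreal (2 * (S\<^sup>2 - 1)) - ennreal (2 * (R\<^sup>2 - 1)) \<le> emeasure cartan_measure {t. cosh t \<in> {R..<S}}"
      by (simp add: ennreal_minus_le_iff add.commute)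
    also have "ennreal (2 * (S\<^sup>2 - 1)) - ennreal (2 * (R\<^sup>2 - 1)) = ennreal (2 * (S\<^sup>2 - R\<^sup>2))"
      using assms(6) by (subst ennreal_minus) (auto simp: algebra_simps)
    also have "emeasure cartan_measure {t. cosh t \<in> {R..<S}} = emeasure haar_SL2 {x \<in> SL2. norm (cayley_diag x) \<in> {R..<S}}"
      by (subst emeasure_haar_SL2_radial) (simp_all del: emeasure_density)
    also have "\<dots> \<le> distribution_fun haar_SL2 f \<alpha>"
      unfolding distribution_fun_def
    proof (rule emeasure_mono)
      show "{x \<in> space haar_SL2. \<alpha> < norm (f x)} \<in> sets haar_SL2" using f by measurable
      show "{x \<in> SL2. norm (cayley_diag x) \<in> {R..<S}} \<subseteq> {x \<in> space haar_SL2. \<alpha> < norm (f x)}"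
      proof clarsimp
        fix x assume x: "x \<in> SL2" "R \<le> norm (cayley_diag x)" "norm (cayley_diag x) < S"
        have p: "norm (cayley_diag x) > 0" using x assms by linarith
        have "norm (cayley_diag x) ^ M < c / \<alpha>"
          unfolding S(2)[symmetric] using x assms by (intro power_strict_mono) auto
        then have "\<alpha> < c / norm (cayley_diag x) ^ M"
          using p assms by (simp add: field_simps)
        also have "\<dots> \<le> norm (f x)" using ge x by blast
        finally show "x \<in> space haar_SL2 \<and> \<alpha> < norm (f x)" using x by (simp add: space_haar_SL2)
      qed
    qed
    finally show ?thesis by (simp add: S(3))
  qed
qed

text \<open>The bound on the distribution function gives \<open>\<alpha>\<^sup>p d(\<alpha>) \<le> 2 C\<^bsup>2/M\<^esup> \<alpha>\<^bsup>p-2/M\<^esup>\<close> for \<open>\<alpha> < C\<close>, and the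
  exponent of \<open>\<alpha>\<close> is nonnegative, so the value at \<open>\<alpha> = C\<close> dominates.\<close>
lemma weak_lorentz_if_decay:
  fixes f :: "real^2^2 \<Rightarrow> complex" and M :: nat
  assumes f: "f \<in> borel_measurable haar_SL2"
    and le: "\<And>x. x \<in> SL2 \<Longrightarrow> norm (f x) \<le> C / norm (cayley_diag x) ^ M"
    and "0 < C" "0 < M" and p: "2 / real M \<le> p"
  shows "f \<in> lorentz_space haar_SL2 p \<infinity>"
proof -
  have "ennreal (\<alpha> powr p) * distribution_fun haar_SL2 f \<alpha> \<le> ennreal (2 * C powr p)" if "0 < \<alpha>" for \<alpha>
  proof (cases "\<alpha> < C")
    case True
    have "ennreal (\<alpha> powr p) * distribution_fun haar_SL2 f \<alpha> \<le> ennreal (\<alpha> powr p) * ennreal (2 * (C / \<alpha>) powr (2 / M))"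
      using distribution_fun_le_of_decay[OF le assms(3,4) that] True by (intro mult_left_mono) auto
    also have "\<dots> = ennreal (2 * C powr (2 / M) * \<alpha> powr (p - 2 / M))"
      using that assms(3) by (simp add: powr_divide powr_diff mult_ac flip: ennreal_mult)
    also have "\<dots> \<le> ennreal (2 * C powr (2 / M) * C powr (p - 2 / M))"
      using p True that by (intro ennreal_leI mult_left_mono powr_mono2) auto
    also have "\<dots> = ennreal (2 * C powr p)" by (simp add: mult.assoc flip: powr_add)
    finally show ?thesis .
  next
    case False
    then show ?thesis using distribution_fun_le_of_decay[OF le assms(3,4) that] by simp
  qed
  then have "(SUP \<alpha>\<in>{0<..}. ennreal (\<alpha> powr p) * distribution_fun haar_SL2 f \<alpha>) \<le> ennreal (2 * C powr p)"
    by (intro SUP_least) auto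
  also have "\<dots> < \<infinity>" by simp
  finally show ?thesis using f by (simp add: lorentz_space_def)
qed

text \<open>Otherwise \<open>\<alpha>\<^sup>p d(\<alpha>)\<close> grows at least like \<open>\<alpha>\<^bsup>-(2/M-p)\<^esup>\<close> as \<open>\<alpha> \<rightarrow> 0\<close>.\<close>
lemma decay_exponent_if_weak_lorentz:
  fixes f :: "real^2^2 \<Rightarrow> complex" and M :: nat
  assumes f: "f \<in> lorentz_space haar_SL2 p \<infinity>"
    and ge: "\<And>x. x \<in> SL2 \<Longrightarrow> R \<le> norm (cayley_diag x) \<Longrightarrow> c / norm (cayley_diag x) ^ M \<le> norm (f x)"
    and "0 < c" "0 < M" "1 \<le> R" "0 < p"
  shows "2 / real M \<le> p"
proof (rule ccontr)
  assume "\<not> 2 / real M \<le> p"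
  define e where "e = 2 / real M - p"
  have e: "e > 0" using \<open>\<not> _\<close> by (simp add: e_def)
  have fm: "f \<in> borel_measurable haar_SL2" using f by (simp add: lorentz_space_def)
  define L where "L = (SUP \<alpha>\<in>{0<..}. ennreal (\<alpha> powr p) * distribution_fun haar_SL2 f \<alpha>)"
  have "L < \<infinity>" using f by (simp add: lorentz_space_def L_def)
  then obtain B where B: "B \<ge> 0" "L = ennreal B" by (metis ennreal_cases infinity_ennreal_def less_irrefl)
  \<comment> \<open>Chosen so that the lower bound for \<open>\<alpha>\<^sup>p d(\<alpha>)\<close> at \<open>\<alpha> = X\<^bsup>-1/e\<^esup>\<close> exceeds \<open>B\<close> by at least \<open>2 c\<^bsup>2/M\<^esup>\<close>.\<close>
  define X where "X = 1 + (B + 2 * R\<^sup>2) / (2 * c powr (2 / M))"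
  have X: "X \<ge> 1" using B assms by (simp add: X_def)
  define \<alpha> where "\<alpha> = X powr (- (1 / e))"
  have \<alpha>: "\<alpha> > 0" "\<alpha> \<le> 1" "\<alpha> powr (- e) = X"
  proof -
    show "\<alpha> > 0" using X by (simp add: \<alpha>_def)
    have "\<alpha> \<le> X powr 0" unfolding \<alpha>_def using X e by (intro powr_mono) auto
    then show "\<alpha> \<le> 1" using X by simp
    show "\<alpha> powr (- e) = X" unfolding \<alpha>_def powr_powr using X e by simp
  qed
  have "ennreal (\<alpha> powr p * (2 * ((c / \<alpha>) powr (2 / M) - R\<^sup>2)))
      = ennreal (\<alpha> powr p) * ennreal (2 * ((c / \<alpha>) powr (2 / M) - R\<^sup>2))"
    by (rule ennreal_mult') simp
  also have "\<dots> \<le> ennreal (\<alpha> powr p) * distribution_fun haar_SL2 f \<alpha>"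
    by (intro mult_left_mono distribution_fun_ge_of_decay[OF fm ge]) (use assms \<alpha> in auto)
  also have "\<dots> \<le> L" unfolding L_def using \<alpha> by (intro SUP_upper) auto
  finally have "\<alpha> powr p * (2 * ((c / \<alpha>) powr (2 / M) - R\<^sup>2)) \<le> B"
    using B by (simp add: ennreal_le_iff)
  moreover have "\<alpha> powr p * (2 * ((c / \<alpha>) powr (2 / M) - R\<^sup>2)) = 2 * c powr (2 / M) * X - 2 * R\<^sup>2 * \<alpha> powr p"
  proof -
    have "\<alpha> powr p * (c / \<alpha>) powr (2 / M) = c powr (2 / M) * \<alpha> powr (- e)"
      using \<alpha>(1) assms(3) by (simp add: e_def powr_divide powr_diff mult_ac)
    then show ?thesis unfolding \<alpha>(3) by (simp add: algebra_simps)
  qed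
  moreover have "2 * R\<^sup>2 * \<alpha> powr p \<le> 2 * R\<^sup>2 * 1"
    using \<alpha> assms by (intro mult_left_mono powr_le1) auto
  moreover have "2 * c powr (2 / M) * X = 2 * c powr (2 / M) + B + 2 * R\<^sup>2"
    using assms by (simp add: X_def field_simps)
  moreover have "c powr (2 / M) > 0" using assms by simp
  ultimately show False by linarith
qed

lemma nn_integral_inverse_near_0:
  fixes K a :: real
  assumes "0 < K" "0 < a"
  shows "(\<integral>\<^sup>+\<alpha>. ennreal (K / \<alpha>) * indicator {0<..a} \<alpha> \<partial>lborel) = \<infinity>"
proof (rule ccontr)
  let ?I = "\<integral>\<^sup>+\<alpha>. ennreal (K / \<alpha>) * indicator {0<..a} \<alpha> \<partial>lborel"
  assume "?I \<noteq> \<infinity>"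
  then obtain B where B: "B \<ge> 0" "?I = ennreal B" by (metis ennreal_cases infinity_ennreal_def)
  \<comment> \<open>Integrating \<open>K/\<alpha>\<close> over \<open>[a e\<^bsup>-s\<^esup>, a]\<close> gives \<open>K s = B + K\<close>.\<close>
  define s where "s = B / K + 1"
  have s: "s > 0" using B assms by (simp add: s_def add_nonneg_pos)
  define \<epsilon> where "\<epsilon> = a * exp (- s)"
  have \<epsilon>: "0 < \<epsilon>" "\<epsilon> \<le> a" using assms s by (simp_all add: \<epsilon>_def)
  have "ennreal (K * ln a - K * ln \<epsilon>) = (\<integral>\<^sup>+\<alpha>. ennreal (K / \<alpha>) * indicator {\<epsilon>..a} \<alpha> \<partial>lborel)"
    by (rule nn_integral_FTC_Icc[symmetric]) (use \<epsilon> assms in \<open>auto intro!: derivative_eq_intros simp: field_simps\<close>)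
  also have "\<dots> \<le> ?I"
    using \<epsilon> by (intro nn_integral_mono) (auto split: split_indicator)
  finally have "K * ln a - K * ln \<epsilon> \<le> B" using B by simp
  moreover have "ln \<epsilon> = ln a - s" using assms by (simp add: \<epsilon>_def ln_mult)
  ultimately have "K * s \<le> B" by (simp add: algebra_simps)
  moreover have "K * s = B + K" using assms by (simp add: s_def distrib_left)
  ultimately show False using assms by linarith
qed

text \<open>The infinite value is covered by the convention \<open>\<infinity>\<^sup>r = \<infinity>\<close>.\<close>
lemma ennreal_powr_lower:
  assumes "ennreal a \<le> x" "0 \<le> a" "0 \<le> r"
  shows "ennreal (a powr r) \<le> ennreal_powr x r"
proof (cases "x = \<infinity>")
  case False
  then have "x < top" by (simp add: less_top)
  then have "a \<le> enn2real x" using assms enn2real_mono[of "ennreal a" x] by simp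
  then show ?thesis using False assms by (auto simp: ennreal_powr_def intro!: ennreal_leI powr_mono2)
qed (simp add: ennreal_powr_def)

text \<open>At the critical exponent \<open>d(\<alpha>) \<ge> (c/\<alpha>)\<^sup>p\<close> for all small \<open>\<alpha>\<close>, so the Lorentz integrand is at
  least \<open>c\<^sup>q/\<alpha>\<close> there, which is not integrable at \<open>0\<close>.\<close>
lemma not_lorentz_at_critical_decay:
  fixes f :: "real^2^2 \<Rightarrow> complex" and M :: nat
  assumes f: "f \<in> borel_measurable haar_SL2"
    and ge: "\<And>x. x \<in> SL2 \<Longrightarrow> R \<le> norm (cayley_diag x) \<Longrightarrow> c / norm (cayley_diag x) ^ M \<le> norm (f x)"
    and "0 < c" "0 < M" "1 \<le> R" and p: "p = 2 / real M" and q: "0 < q" "q \<noteq> \<infinity>"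
  shows "f \<notin> lorentz_space haar_SL2 p q"
proof
  assume fq: "f \<in> lorentz_space haar_SL2 p q"
  define r where "r = enn2real q"
  have r: "r > 0" using q by (simp add: r_def enn2real_positive_iff less_top)
  have p0: "p > 0" using p assms by simp
  define D where "D = distribution_fun haar_SL2 f"
  have fin: "(\<integral>\<^sup>+\<alpha>\<in>{0<..}. ennreal (\<alpha> powr r) * ennreal_powr (D \<alpha>) (r / p) * ennreal (1 / \<alpha>) \<partial>lborel) < \<infinity>"
    using fq q by (simp add: lorentz_space_def r_def D_def)
  \<comment> \<open>Below this level the loss \<open>R\<^sup>2\<close> in the lower bound is at most half of the main term.\<close>
  define a where "a = c / (2 * R\<^sup>2) powr (1 / p)"
  have a: "a > 0" using assms by (simp add: a_def)
  have "(\<integral>\<^sup>+\<alpha>. ennreal (c powr r / \<alpha>) * indicator {0<..a} \<alpha> \<partial>lborel)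
     \<le> (\<integral>\<^sup>+\<alpha>\<in>{0<..}. ennreal (\<alpha> powr r) * ennreal_powr (D \<alpha>) (r / p) * ennreal (1 / \<alpha>) \<partial>lborel)"
  proof (rule nn_integral_mono)
    fix \<alpha> :: real
    show "ennreal (c powr r / \<alpha>) * indicator {0<..a} \<alpha> \<le>
       ennreal (\<alpha> powr r) * ennreal_powr (D \<alpha>) (r / p) * ennreal (1 / \<alpha>) * indicator {0<..} \<alpha>"
    proof (cases "\<alpha> \<in> {0<..a}")
      case True
      then have \<alpha>: "0 < \<alpha>" "\<alpha> \<le> a" by auto
      have "(2 * R\<^sup>2) powr (1 / p) > 0" using assms(5) by simp
      then have "(2 * R\<^sup>2) powr (1 / p) \<le> c / \<alpha>" using \<alpha> unfolding a_def by (simp add: field_simps)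
      then have "((2 * R\<^sup>2) powr (1 / p)) powr p \<le> (c / \<alpha>) powr p" using p0 by (intro powr_mono2) auto
      then have "2 * R\<^sup>2 \<le> (c / \<alpha>) powr p" using p0 assms by (simp add: powr_powr)
      then have "ennreal ((c / \<alpha>) powr p) \<le> ennreal (2 * ((c / \<alpha>) powr p - R\<^sup>2))"
        by (intro ennreal_leI) (simp add: right_diff_distrib)
      also have "\<dots> \<le> D \<alpha>" unfolding D_def p by (rule distribution_fun_ge_of_decay[OF f ge]) (use assms \<alpha> in auto)
      finally have "ennreal (((c / \<alpha>) powr p) powr (r / p)) \<le> ennreal_powr (D \<alpha>) (r / p)"
        using r p0 by (intro ennreal_powr_lower) auto
      then have D: "ennreal ((c / \<alpha>) powr r) \<le> ennreal_powr (D \<alpha>) (r / p)" using p0 by (simp add: powr_powr)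
      have "ennreal (c powr r / \<alpha>) = ennreal (\<alpha> powr r) * ennreal ((c / \<alpha>) powr r) * ennreal (1 / \<alpha>)"
        using \<alpha> assms by (simp add: powr_divide flip: ennreal_mult)
      also have "\<dots> \<le> ennreal (\<alpha> powr r) * ennreal_powr (D \<alpha>) (r / p) * ennreal (1 / \<alpha>)"
        by (intro mult_right_mono mult_left_mono D) auto
      finally show ?thesis using \<alpha> by simp
    qed simp
  qed
  then show False using fin nn_integral_inverse_near_0[of "c powr r" a] a assms by simp
qed

lemma continuous_on_cayley_off: "continuous_on S cayley_off"
  unfolding cayley_off_def[abs_def] by (intro continuous_intros) auto

lemma continuous_ds_poly: "continuous_on S (ds_poly j l)"
  unfolding ds_poly_def[abs_def] by (intro continuous_intros)

lemma ds_coeff_measurable: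
  assumes "n \<in> Z_types k"
  shows "ds_coeff k n \<in> borel_measurable haar_SL2"
proof -
  obtain j where j: "\<bar>n\<bar> = int (2 * j + nat \<bar>k\<bar> + 1)" using Z_types_abs[OF assms] .
  have nz: "cayley_diag x \<noteq> 0" if "x \<in> SL2" for x
    using cayley_off_less_diag[OF that] by auto
  have "continuous_on SL2 (ds_coeff k n)"
    by (subst continuous_on_cong[OF refl ds_coeff_formula[OF assms j]], assumption, cases "n > 0")
       (auto intro!: continuous_intros continuous_on_compose2[OF continuous_ds_poly[of UNIV]]
          continuous_on_cayley_diag continuous_on_cayley_off simp: nz)
  then have "ds_coeff k n \<in> borel_measurable (restrict_space borel SL2)"
    by (rule borel_measurable_continuous_on_restrict)
  then show ?thesis by (simp add: haar_SL2_def)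
qed

text \<open>The polynomial factor is bounded on \<open>[0,1]\<close> and tends to a nonzero limit at \<open>1\<close>, so the coefficient
  is comparable to \<open>|\<alpha>|\<^bsup>-(|k|+1)\<^esup>\<close> near infinity. Zeros of the polynomial inside \<open>(0,1)\<close>
  can restrict the lower bound to large \<open>|\<alpha>|\<close>.\<close>
lemma ds_coeff_bounds:
  assumes n: "n \<in> Z_types k"
  obtains C c R where "0 < C" "0 < c" "1 \<le> R"
    "\<And>x. x \<in> SL2 \<Longrightarrow> norm (ds_coeff k n x) \<le> C / norm (cayley_diag x) ^ (nat \<bar>k\<bar> + 1)"
    "\<And>x. x \<in> SL2 \<Longrightarrow> R \<le> norm (cayley_diag x) \<Longrightarrow> c / norm (cayley_diag x) ^ (nat \<bar>k\<bar> + 1) \<le> norm (ds_coeff k n x)"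
proof -
  obtain j where j: "\<bar>n\<bar> = int (2 * j + nat \<bar>k\<bar> + 1)" using Z_types_abs[OF n] .
  define Q where "Q = ds_poly j (nat \<bar>k\<bar>)"
  note norm = norm_ds_coeff[OF n j, folded Q_def]
  have one: "1 \<le> norm (cayley_diag x)" if "x \<in> SL2" for x
  proof -
    have "1 \<le> norm (cayley_diag x) ^ 2" using cayley_norm_diff[OF that] zero_le_power2[of "norm (cayley_off x)"] by linarith
    then show ?thesis using power2_le_imp_le[of 1 "norm (cayley_diag x)"] by simp
  qed
  have "compact (Q ` {0..1})"
    unfolding Q_def by (intro compact_continuous_image continuous_ds_poly) auto
  then obtain C where C: "C > 0" "\<And>s. s \<in> {0..1} \<Longrightarrow> \<bar>Q s\<bar> \<le> C"
    by (auto dest!: compact_imp_bounded simp: bounded_pos)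
  have Q1: "Q 1 \<noteq> 0" by (simp add: Q_def ds_poly_1)
  have "isCont Q 1" using continuous_ds_poly[of UNIV] by (simp add: Q_def continuous_on_eq_continuous_at)
  moreover have "((\<lambda>y::real. 1 - 1 / y\<^sup>2) \<longlongrightarrow> 1 - 0) at_top"
    by (intro tendsto_intros tendsto_divide_0[OF tendsto_const] filterlim_at_top_imp_at_infinity filterlim_pow_at_top filterlim_ident) auto
  ultimately have "((\<lambda>y. \<bar>Q (1 - 1 / y\<^sup>2)\<bar>) \<longlongrightarrow> \<bar>Q 1\<bar>) at_top"
    by (intro tendsto_rabs isCont_tendsto_compose[of 1 Q]) auto
  then have "eventually (\<lambda>y. \<bar>Q 1\<bar> / 2 < \<bar>Q (1 - 1 / y\<^sup>2)\<bar>) at_top"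
    by (rule order_tendstoD) (use Q1 in simp)
  then obtain R where R: "\<And>y. R \<le> y \<Longrightarrow> \<bar>Q 1\<bar> / 2 < \<bar>Q (1 - 1 / y\<^sup>2)\<bar>"
    by (auto simp: eventually_at_top_linorder)
  show thesis
  proof
    show "0 < C" "0 < \<bar>Q 1\<bar> / 2" "1 \<le> max 1 R" using C Q1 by auto
    fix x assume x: "x \<in> SL2"
    have "1 \<le> norm (cayley_diag x) ^ 2" using one[OF x] by (rule one_le_power)
    then have "1 / norm (cayley_diag x) ^ 2 \<le> 1" by (subst divide_le_eq_1_pos) linarith+
    then have "1 - 1 / norm (cayley_diag x) ^ 2 \<in> {0..1}" by simp
    then show "norm (ds_coeff k n x) \<le> C / norm (cayley_diag x) ^ (nat \<bar>k\<bar> + 1)"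
      unfolding norm[OF x] using C(2) by (intro divide_right_mono) auto
    assume "max 1 R \<le> norm (cayley_diag x)"
    then show "(\<bar>Q 1\<bar> / 2) / norm (cayley_diag x) ^ (nat \<bar>k\<bar> + 1) \<le> norm (ds_coeff k n x)"
      unfolding norm[OF x] using R[of "norm (cayley_diag x)"] by (intro divide_right_mono) auto
  qed
qed

theorem lemma5p8:
  fixes p \<gamma> :: real and k n :: int
  assumes "0 < p" and "p \<le> 2"
    and "\<gamma> = 2 / p - 1"
    and "k \<noteq> 0" and "n \<in> Z_types k"
  shows "(\<gamma> \<le> real_of_int \<bar>k\<bar> \<longleftrightarrow> ds_coeff k n \<in> lorentz_space haar_SL2 p \<infinity>)
    \<and> (real_of_int \<bar>k\<bar> = \<gamma> \<longrightarrow>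
        (\<forall>q::ennreal. 0 < q \<longrightarrow> (ds_coeff k n \<in> lorentz_space haar_SL2 p q \<longleftrightarrow> q = \<infinity>)))"
proof -
  define M where "M = nat \<bar>k\<bar> + 1"
  have M: "0 < M" "real M = real_of_int \<bar>k\<bar> + 1" by (simp_all add: M_def)
  obtain C c R where b: "0 < C" "0 < c" "1 \<le> R"
    and up: "\<And>x. x \<in> SL2 \<Longrightarrow> norm (ds_coeff k n x) \<le> C / norm (cayley_diag x) ^ M"
    and lo: "\<And>x. x \<in> SL2 \<Longrightarrow> R \<le> norm (cayley_diag x) \<Longrightarrow> c / norm (cayley_diag x) ^ M \<le> norm (ds_coeff k n x)"
    using ds_coeff_bounds[OF assms(5)] unfolding M_def by metis
  note meas = ds_coeff_measurable[OF assms(5)]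
  have "\<gamma> \<le> real_of_int \<bar>k\<bar> \<longleftrightarrow> 2 / p \<le> real M" using assms(3) M(2) by linarith
  also have "\<dots> \<longleftrightarrow> 2 / real M \<le> p" using assms(1) M(1) by (simp add: field_simps)
  finally have cond: "\<gamma> \<le> real_of_int \<bar>k\<bar> \<longleftrightarrow> 2 / real M \<le> p" .
  have weak: "\<gamma> \<le> real_of_int \<bar>k\<bar> \<longleftrightarrow> ds_coeff k n \<in> lorentz_space haar_SL2 p \<infinity>"
    unfolding cond
    using weak_lorentz_if_decay[OF meas up b(1) M(1)] decay_exponent_if_weak_lorentz[OF _ lo b(2) M(1) b(3) assms(1)] by blast
  have "ds_coeff k n \<in> lorentz_space haar_SL2 p q \<longleftrightarrow> q = \<infinity>"
    if "real_of_int \<bar>k\<bar> = \<gamma>" "0 < q" for q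
  proof (cases "q = \<infinity>")
    case True
    then show ?thesis using weak that by simp
  next
    case False
    have "real M = 2 / p" using that(1) assms(3) M(2) by linarith
    then have "p = 2 / real M" using assms(1) M(1) by (simp add: field_simps)
    then show ?thesis using not_lorentz_at_critical_decay[OF meas lo b(2) M(1) b(3) _ that(2) False] False by blast
  qed
  with weak show ?thesis by blast
qed

end
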